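(* Let the data $X,X_j,\gamma_j,A,Y,\varphi,j,f,R,q,a_S$ satisfy the standing assumptions listed in the context (unconstrained case $K=X$), and let $j_c:X_j\to X_j^*$ be a linear operator such that $\|j_c(z)\|_{X_j^*}\le\alpha_c\|z\|_{X_j}$ and $\langle j_c(z),z\rangle_{X_j}\ge\alpha_j\|z\|_{X_j}^2$ for all $z\in X_j$. Assume $$\alpha_\varphi+\alpha_jc_j^2<m_A,\qquad \alpha_\varphi+\alpha_cc_j^2<m_A/3,$$ that there is a constant $c_\varphi>0$ with $$\varphi(y,w,v_1)+\varphi(y,w,v_2)-2\varphi\left(y,w,\tfrac{v_1+v_2}{2}\right)\le c_\varphi\|v_1-v_2\|_X^2\qquad\forall\,y\in Y,\ \forall\,w,v_1,v_2\in X,$$ that $q\in C^2(\mathbb R_+\times\mathbb R_+;\mathcal L(X))$, and that the solution $u\in C(\mathbb R_+;X)$ of the continuous problem stated in the context satisfies $u\in W^{2,\infty}_{loc}(\mathbb R_+;X)$. Fix $T>0$. For a positive integer $N$, $k=T/N$, and a mesh parameter $h$, let $u^{kh}=\{u_n^{kh}\}_{n=0}^N\subset K^h=X^h$ be such that for every $2\le n\le N$ and every $v^h\in K^h$, $$\langle Au_n^{kh},v^h-u_n^{kh}\rangle+\varphi(\mathcal S_{n,L}^ku^{kh},2u_{n-1}^{kh}-u_{n-2}^{kh},v^h)-\varphi(\mathcal S_{n,L}^ku^{kh},2u_{n-1}^{kh}-u_{n-2}^{kh},u_n^{kh})+j^0(\gamma_ju_n^{kh};\gamma_jv^h-\gamma_ju_n^{kh})$$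 $$+\langle j_c(\gamma_ju_n^{kh}),\gamma_jv^h-\gamma_ju_n^{kh}\rangle_{X_j}\ge\langle f_n,v^h-u_n^{kh}\rangle+\langle j_c(2\gamma_ju_{n-1}^{kh}-\gamma_ju_{n-2}^{kh}),\gamma_jv^h-\gamma_ju_n^{kh}\rangle_{X_j},$$ and for $n=0,1$ and every $v^h\in K^h$, $$\langle Au_n^{kh},v^h-u_n^{kh}\rangle+\varphi(\mathcal S_{n,L}^ku^{kh},u_n^{kh},v^h)-\varphi(\mathcal S_{n,L}^ku^{kh},u_n^{kh},u_n^{kh})+j^0(\gamma_ju_n^{kh};\gamma_jv^h-\gamma_ju_n^{kh})\ge\langle f_n,v^h-u_n^{kh}\rangle.$$ Then there is a constant $C>0$ independent of $k$ and $h$ such that, with $u_n=u(t_n)$, $$\max_{0\le n\le N}\|u_n-u_n^{kh}\|_X\le C\left(\max_{0\le n\le N}\inf_{v^h\in K^h}\left\{\|u_n-v^h\|_X+\|\gamma_ju_n-\gamma_jv^h\|_{X_j}^{1/2}\right\}+k^2\right).$$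
   Context: Notation. All spaces are real. $\mathbb R_+=[0,\infty)$; $X^*,X_j^*$ are topological duals; $\langle\cdot,\cdot\rangle$ is the duality pairing between $X^*$ and $X$, $\langle\cdot,\cdot\rangle_{X_j}$ the one between $X_j^*$ and $X_j$; $\mathcal L(\cdot;\cdot)$ denotes bounded linear operators, $\mathcal L(X)=\mathcal L(X;X)$. For a locally Lipschitz $j:X_j\to\mathbb R$, the Clarke directional derivative is $j^0(x;v)=\limsup_{y\to x,\lambda\downarrow0}\frac{j(y+\lambda v)-j(y)}{\lambda}$ and $\partial j(x)=\{\xi\in X_j^*: j^0(x;v)\ge\langle\xi,v\rangle_{X_j}\ \forall v\in X_j\}$. Standing assumptions on the data. $X$ is a reflexive Banach space. $X_j$ is a Banach space, $\gamma_j\in\mathcal L(X;X_j)$ and $c_j>0$ satisfies $\|\gamma_jv\|_{X_j}\le c_j\|v\|_X$ for all $v\in X$. $A:X\to X^*$ is Lipschitz continuous with constant $L_A>0$ and strongly monotone: $\langle Av_1-Av_2,v_1-v_2\rangle\ge m_A\|v_1-v_2\|_X^2$ for all $v_1,v_2\in X$, with $m_A>0$. $Y$ is a normed space and $\varphi:Y\times X\times X\to\mathbb R$ is such that $\varphi(y,u,\cdot)$ is convex and lower semicontinuous on $X$ for all $y\in Y,u\in X$, and there are $\alpha_\varphi>0,\beta_\varphi>0$ with $\varphi(y_1,u_1,v_2)-\varphi(y_1,u_1,v_1)+\varphi(y_2,u_2,v_1)-\varphi(y_2,u_2,v_2)\le\alpha_\varphi\|u_1-u_2\|_X\|v_1-v_2\|_X+\beta_\varphi\|y_1-y_2\|_Y\|v_1-v_2\|_X$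 for all $y_1,y_2\in Y$, $u_1,u_2,v_1,v_2\in X$. The function $j:X_j\to\mathbb R$ is locally Lipschitz; there are $c_0,c_1\ge0$ with $\|\xi\|_{X_j^*}\le c_0+c_1\|z\|_{X_j}$ for all $z\in X_j$, $\xi\in\partial j(z)$; there is $\alpha_j>0$ with $j^0(z_1;z_2-z_1)+j^0(z_2;z_1-z_2)\le\alpha_j\|z_1-z_2\|_{X_j}^2$ for all $z_1,z_2\in X_j$. $f\in C(\mathbb R_+;X^* )$. $R\in\mathcal L(X;Y)$, $q\in C(\mathbb R_+\times\mathbb R_+;\mathcal L(X))$, $a_S\in X$; these define the history-dependent operator $(\mathcal Sv)(t)=R\left(\int_0^tq(t,s)v(s)\,ds+a_S\right)$ for $v\in C(\mathbb R_+;X)$. Continuous problem. Find $u\in C(\mathbb R_+;X)$ such that for all $t\in\mathbb R_+$ and all $v\in X$, $\langle Au(t),v-u(t)\rangle+\varphi((\mathcal Su)(t),u(t),v)-\varphi((\mathcal Su)(t),u(t),u(t))+j^0(\gamma_ju(t);\gamma_jv-\gamma_ju(t))\ge\langle f(t),v-u(t)\rangle$. Discretization. $t_n=nk$, $0\le n\le N$, $f_n=f(t_n)$. For a sequence $v=\{v_n\}$ in $X$ and $n\ge1$, $\mathcal S_{n,L}^kv=R\left(\frac k2q(t_n,t_0)v_0+k\sum_{i=1}^{n-1}q(t_n,t_i)v_i+\frac k2q(t_n,t_{n-1})v_{n-1}+a_S\right)$ (empty sum $=0$), and $\mathcal S_{0,L}^kv=R\,a_S$. For each $h$, $X^h\subset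 X$ is a (finite-dimensional, conforming) finite element space associated with a mesh of size $h$ from a regular family of partitions; since $K=X$, $K^h=X^h\cap K=X^h$. *)

theory Defs
  imports "HOL-Analysis.Analysis"
begin

text \<open>The topological dual of a normed space is the type of bounded linear functionals
  \<open>'a \<Rightarrow>\<^sub>L real\<close> with the operator norm; the duality pairing is function application.\<close>

definition reflexive_space :: "'a::real_normed_vector itself \<Rightarrow> bool" where
  "reflexive_space _ \<longleftrightarrow>
     (\<forall>F :: ('a \<Rightarrow>\<^sub>L real) \<Rightarrow>\<^sub>L real. \<exists>x :: 'a. \<forall>\<xi> :: 'a \<Rightarrow>\<^sub>L real.
        blinfun_apply F \<xi> = blinfun_apply \<xi> x)"

definition lower_semicontinuous :: "('a::topological_space \<Rightarrow> real) \<Rightarrow> bool" where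
  "lower_semicontinuous f \<longleftrightarrow> (\<forall>x. \<forall>a < f x. \<forall>\<^sub>F y in nhds x. a < f y)"

definition locally_lipschitz :: "('a::metric_space \<Rightarrow> 'b::metric_space) \<Rightarrow> bool" where
  "locally_lipschitz f \<longleftrightarrow> (\<forall>x. \<exists>r>0. \<exists>L. L-lipschitz_on (ball x r) f)"

text \<open>The upper limit is taken in the extended reals, since \<^const>\<open>Limsup\<close> needs a complete
  lattice; for locally Lipschitz \<open>j\<close> it is finite, so the conversion back is harmless.\<close>

definition clarke_deriv :: "('a::real_normed_vector \<Rightarrow> real) \<Rightarrow> 'a \<Rightarrow> 'a \<Rightarrow> real" where
  "clarke_deriv j x v =
     real_of_ereal (Limsup (nhds x \<times>\<^sub>F at_right 0)
       (\<lambda>(y, r). ereal ((j (y + r *\<^sub>R v) - j y) / r)))"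

definition clarke_subdiff :: "('a::real_normed_vector \<Rightarrow> real) \<Rightarrow> 'a \<Rightarrow> ('a \<Rightarrow>\<^sub>L real) set" where
  "clarke_subdiff j x = {\<xi>. \<forall>v. clarke_deriv j x v \<ge> blinfun_apply \<xi> v}"

text \<open>On a set such as a closed quadrant, derivatives are relative to the set, hence one-sided
  at the boundary (they are still unique there).\<close>

definition C2_on :: "'a::real_normed_vector set \<Rightarrow> ('a \<Rightarrow> 'b::real_normed_vector) \<Rightarrow> bool" where
  "C2_on S g \<longleftrightarrow>
     (\<exists>(g' :: 'a \<Rightarrow> 'a \<Rightarrow>\<^sub>L 'b) (g'' :: 'a \<Rightarrow> 'a \<Rightarrow>\<^sub>L ('a \<Rightarrow>\<^sub>L 'b)).
        (\<forall>p\<in>S. (g has_derivative blinfun_apply (g' p)) (at p within S)) \<and>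
        (\<forall>p\<in>S. (g' has_derivative blinfun_apply (g'' p)) (at p within S)) \<and>
        continuous_on S g'')"

text \<open>Lebesgue and Sobolev spaces of functions on \<open>(0, T)\<close> with values in a possibly
  non-separable Banach space. Measurability is strong (Bochner) measurability. The library's
  Bochner integral is restricted to second countable spaces, so integrals are Henstock--Kurzweil
  integrals; for Bochner integrable functions the two integrals agree.\<close>

definition Linf :: "real \<Rightarrow> (real \<Rightarrow> 'a::banach) \<Rightarrow> bool" where
  "Linf T g \<longleftrightarrow>
     (\<exists>s. (\<forall>n::nat. simple_function (lebesgue_on {0<..<T}) (s n)) \<and>
          (AE t in lebesgue_on {0<..<T}. (\<lambda>n. s n t) \<longlonglongrightarrow> g t)) \<and>
     (\<exists>M. AE t in lebesgue_on {0<..<T}. norm (g t) \<le> M)"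

definition test_function :: "real \<Rightarrow> (real \<Rightarrow> real) \<Rightarrow> bool" where
  "test_function T \<psi> \<longleftrightarrow>
     (\<forall>n. ((deriv ^^ n) \<psi>) differentiable_on UNIV) \<and>
     (\<exists>K. compact K \<and> K \<subseteq> {0<..<T} \<and> (\<forall>t. t \<notin> K \<longrightarrow> \<psi> t = 0))"

definition weak_deriv :: "real \<Rightarrow> (real \<Rightarrow> 'a::banach) \<Rightarrow> (real \<Rightarrow> 'a) \<Rightarrow> bool" where
  "weak_deriv T g g' \<longleftrightarrow>
     (\<forall>\<psi>. test_function T \<psi> \<longrightarrow>
        integral {0..T} (\<lambda>t. deriv \<psi> t *\<^sub>R g t) = - integral {0..T} (\<lambda>t. \<psi> t *\<^sub>R g' t))"

definition W2inf :: "real \<Rightarrow> (real \<Rightarrow> 'a::banach) \<Rightarrow> bool" where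
  "W2inf T g \<longleftrightarrow>
     (\<exists>g' g''. Linf T g \<and> Linf T g' \<and> Linf T g'' \<and> weak_deriv T g g' \<and> weak_deriv T g' g'')"

definition W2inf_loc :: "(real \<Rightarrow> 'a::banach) \<Rightarrow> bool" where
  "W2inf_loc g \<longleftrightarrow> (\<forall>T>0. W2inf T g)"

definition history_op ::
  "('x::banach \<Rightarrow>\<^sub>L 'y::real_normed_vector) \<Rightarrow> (real \<times> real \<Rightarrow> 'x \<Rightarrow>\<^sub>L 'x) \<Rightarrow> 'x \<Rightarrow>
   (real \<Rightarrow> 'x) \<Rightarrow> real \<Rightarrow> 'y" where
  "history_op R q aS v t = R (integral {0..t} (\<lambda>s. q (t, s) (v s)) + aS)"

text \<open>Trapezoidal rule on the grid \<open>t\<^sub>i = i k\<close>, with the term \<open>q(t\<^sub>n, t\<^sub>n) v\<^sub>n\<close> replaced by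
  \<open>q(t\<^sub>n, t\<^sub>n\<^sub>-\<^sub>1) v\<^sub>n\<^sub>-\<^sub>1\<close>, so that the operator is explicit.\<close>

definition history_discr ::
  "('x::banach \<Rightarrow>\<^sub>L 'y::real_normed_vector) \<Rightarrow> (real \<times> real \<Rightarrow> 'x \<Rightarrow>\<^sub>L 'x) \<Rightarrow> 'x \<Rightarrow>
   real \<Rightarrow> nat \<Rightarrow> (nat \<Rightarrow> 'x) \<Rightarrow> 'y" where
  "history_discr R q aS k n v =
     (let t = (\<lambda>i::nat. real i * k) in
      if n = 0 then R aS
      else R ((k / 2) *\<^sub>R q (t n, t 0) (v 0)
              + k *\<^sub>R (\<Sum>i = 1..n - 1. q (t n, t i) (v i))
              + (k / 2) *\<^sub>R q (t n, t (n - 1)) (v (n - 1))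
              + aS))"

end

theory Submission
  imports Defs
begin

text \<open>
  Test the exact inequality at time \<open>t\<^sub>n\<close> with the discrete solution \<open>w\<^sub>n\<close>, test the discrete
  one with \<open>v \<in> X\<^sup>h\<close>, and add. Strong monotonicity of \<open>A\<close> gives \<open>m\<^sub>A E\<^sub>n\<^sup>2\<close> for the error \<open>E\<^sub>n\<close> on
  one side. On the other side there are three kinds of terms.

  \<^item> The terms of \<open>j\<close> yield at most \<open>\<alpha>\<^sub>j \<parallel>\<gamma>(u\<^sub>n - w\<^sub>n)\<parallel>\<^sup>2\<close>, which the coercivity of \<open>j\<^sub>c\<close> cancels for
    \<open>n \<ge> 2\<close> and which \<open>m\<^sub>A\<close> absorbs for \<open>n = 0, 1\<close>. The terms that carry the extrapolation
    \<open>2 w\<^sub>n\<^sub>-\<^sub>1 - w\<^sub>n\<^sub>-\<^sub>2\<close> contribute \<open>a e E\<^sub>n\<close> with \<open>a = \<alpha>\<^sub>\<phi> + \<alpha>\<^sub>c c\<^sub>j\<^sup>2\<close> and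
    \<open>e \<le> 2 E\<^sub>n\<^sub>-\<^sub>1 + E\<^sub>n\<^sub>-\<^sub>2 + O(k\<^sup>2)\<close>. The coefficients of the extrapolation have absolute sum 3, so
    \<open>3 a < m\<^sub>A\<close> makes the recursion a contraction (\<open>quadratic_estimate\<close>, \<open>two_step_gronwall\<close>).
  \<^item> The residual \<open>\<langle>A u\<^sub>n - f\<^sub>n, v - u\<^sub>n\<rangle> + \<phi>(v) - \<phi>(u\<^sub>n)\<close> is only of first order in \<open>v - u\<^sub>n\<close>.
    The exact inequality at the reflected point \<open>2 u\<^sub>n - v\<close> bounds its linear part; what remains is
    a midpoint defect of \<open>\<phi>\<close>, quadratic in \<open>v - u\<^sub>n\<close>, and terms of size \<open>\<parallel>\<gamma>(u\<^sub>n - v)\<parallel>\<close>. This is where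
    the square root in the estimate comes from (\<open>step_inequality\<close>). Bounding the Clarke derivative
    by \<open>\<parallel>\<gamma>(u\<^sub>n - v)\<parallel>\<close> needs enough subgradients, which the Hahn--Banach theorem supplies
    (\<open>sublinear_supporting_functional\<close>, \<open>clarke_deriv_growth\<close>).
  \<^item> The quadrature error of the history term splits into a consistency part \<open>O(k\<^sup>2)\<close> and a
    stability part \<open>O(k) (E\<^sub>0 + \<dots> + E\<^sub>n\<^sub>-\<^sub>1)\<close>, which a discrete Gronwall argument handles
    (\<open>history_discr_consistent\<close>, \<open>history_discr_stable\<close>).

  The regularity of \<open>u\<close> enters only through bounds on its first and second differences.
  Such differences are limits of integrals of \<open>u\<close> against first and second derivatives of smooth test
  functions, so that the weak derivatives bound them directly, without differentiating \<open>u\<close>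
  pointwise (\<open>weak_lipschitz\<close>, \<open>weak_second_difference\<close>). The trapezoidal rule, too, is estimated from
  second differences alone (\<open>trapezoid_error\<close>).
\<close>

section \<open>Linear minorants of sublinear functionals\<close>

definition sublinear :: "('a::real_vector \<Rightarrow> real) \<Rightarrow> bool" where
  "sublinear p \<longleftrightarrow> (\<forall>v w. p (v + w) \<le> p v + p w) \<and> (\<forall>c>0. \<forall>v. p (c *\<^sub>R v) = c * p v)"

lemma sublinearD:
  assumes "sublinear p"
  shows "p (v + w) \<le> p v + p w" and "c > 0 \<Longrightarrow> p (c *\<^sub>R v) = c * p v"
  using assms by (auto simp: sublinear_def)

lemma sublinear_zero: "sublinear p \<Longrightarrow> p 0 = 0"
  using sublinearD(2)[of p 2 0] by simp

lemma sublinear_minus: "sublinear p \<Longrightarrow> - p (- v) \<le> p v"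
  using sublinearD(1)[of p v "- v"] sublinear_zero[of p] by simp

lemma sublinear_minus_le: "sublinear p \<Longrightarrow> sublinear r \<Longrightarrow> r \<le> p \<Longrightarrow> - p (- v) \<le> r v"
  using sublinear_minus[of r v] by (auto simp: le_fun_def) (smt (verit))

lemma sublinear_scaleR: 
  assumes "sublinear p" "c \<ge> 0" shows "p (c *\<^sub>R v) = c * p v"
  using assms sublinearD(2)[of p c v] sublinear_zero[of p] by (cases "c = 0") auto

text \<open>Passing from \<open>p\<close> to \<open>tilt p x\<close> forces linearity along \<open>x\<close>: the value at \<open>- x\<close> falls to at
  most \<open>- p x\<close>, so every linear functional below \<open>tilt p x\<close> agrees with \<open>p\<close> at \<open>x\<close>.\<close>

definition tilt :: "('a::real_vector \<Rightarrow> real) \<Rightarrow> 'a \<Rightarrow> 'a \<Rightarrow> real" where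
  "tilt p x v = (INF t\<in>{0..}. p (v + t *\<^sub>R x) - t * p x)"

text \<open>The lower bound does not depend on \<open>t\<close>, which makes the real infimum in \<open>tilt\<close> a genuine one.\<close>

lemma tilt_lower:
  assumes "sublinear p" "t \<ge> 0"
  shows "- p (- v) \<le> p (v + t *\<^sub>R x) - t * p x"
  using sublinearD(1)[OF assms(1), of "v + t *\<^sub>R x" "- v"] sublinear_scaleR[OF assms, of x]
  by simp

lemma tilt_le:
  assumes "sublinear p" "t \<ge> 0"
  shows "tilt p x v \<le> p (v + t *\<^sub>R x) - t * p x"
  unfolding tilt_def
  by (rule cINF_lower) (use assms tilt_lower in \<open>auto intro!: bdd_belowI2\<close>)

lemma tilt_greatest:
  assumes "\<And>t. t \<ge> 0 \<Longrightarrow> b \<le> p (v + t *\<^sub>R x) - t * p x"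
  shows "b \<le> tilt p x v"
  unfolding tilt_def by (rule cINF_greatest) (use assms in auto)

lemma sublinear_tilt:
  assumes p: "sublinear p"
  shows "sublinear (tilt p x)"
  unfolding sublinear_def
proof (intro conjI allI impI)
  fix v w
  have "tilt p x (v + w) - (p (v + s *\<^sub>R x) - s * p x) \<le> p (w + t *\<^sub>R x) - t * p x" 
    if "s \<ge> 0" "t \<ge> 0" for s t
    using tilt_le[OF p, of "s + t" x "v + w"] that
      sublinearD(1)[OF p, of "v + s *\<^sub>R x" "w + t *\<^sub>R x"]
    by (simp add: algebra_simps)
  then have "tilt p x (v + w) - (p (v + s *\<^sub>R x) - s * p x) \<le> tilt p x w" if "s \<ge> 0" for s
    using that by (intro tilt_greatest) auto
  then have "tilt p x (v + w) - tilt p x w \<le> p (v + s *\<^sub>R x) - s * p x" if "s \<ge> 0" for s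
    using that by (smt (verit))
  then have "tilt p x (v + w) - tilt p x w \<le> tilt p x v"
    by (intro tilt_greatest) auto
  then show "tilt p x (v + w) \<le> tilt p x v + tilt p x w" by simp
next
  have le: "c * tilt p x v \<le> tilt p x (c *\<^sub>R v)" if c: "c > 0" for c v
  proof (rule tilt_greatest)
    fix t :: real assume "t \<ge> 0"
    then have "tilt p x v \<le> p (v + (t / c) *\<^sub>R x) - (t / c) * p x"
      using c by (intro tilt_le p) auto
    then have "c * tilt p x v \<le> c * p (v + (t / c) *\<^sub>R x) - t * p x"
      using c by (simp add: field_simps)
    also have "c * p (v + (t / c) *\<^sub>R x) = p (c *\<^sub>R v + t *\<^sub>R x)"
      using c sublinearD(2)[OF p c, of "v + (t / c) *\<^sub>R x"] by (simp add: algebra_simps)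
    finally show "c * tilt p x v \<le> p (c *\<^sub>R v + t *\<^sub>R x) - t * p x" .
  qed
  fix c :: real and v assume c: "c > 0"
  show "tilt p x (c *\<^sub>R v) = c * tilt p x v"
    using le[OF c, of v] le[of "1 / c" "c *\<^sub>R v"] c by (simp add: field_simps)
qed

lemma tilt_le_self: "sublinear p \<Longrightarrow> tilt p x \<le> p"
  using tilt_le[of p 0 x] by (auto simp: le_fun_def)

lemma tilt_minus: "sublinear p \<Longrightarrow> tilt p x (- x) \<le> - p x"
  using tilt_le[of p 1 x "- x"] sublinear_zero[of p] by simp

text \<open>The chain condition gives subadditivity of the infimum: two members that nearly attain it at
  \<open>v\<close> and at \<open>w\<close> can be replaced by the smaller of the two. The common upper bound \<open>p\<close> keeps the
  infimum finite.\<close>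

lemma sublinear_chain_Inf:
  assumes C: "C \<noteq> {}" "\<And>r. r \<in> C \<Longrightarrow> sublinear r \<and> r \<le> p"
    and chain: "\<And>r s. r \<in> C \<Longrightarrow> s \<in> C \<Longrightarrow> r \<le> s \<or> s \<le> r"
    and p: "sublinear p"
  defines "m \<equiv> \<lambda>v. INF r\<in>C. r v"
  shows "sublinear m" and "\<And>r. r \<in> C \<Longrightarrow> m \<le> r"
proof -
  have bdd: "bdd_below ((\<lambda>r. r v) ` C)" for v
    using C sublinear_minus_le[OF p] by (intro bdd_belowI2[where m="- p (- v)"]) auto
  have lower: "m v \<le> r v" if "r \<in> C" for r v
    unfolding m_def by (rule cINF_lower[OF bdd that])
  show "m \<le> r" if "r \<in> C" for r using lower[OF that] by (auto simp: le_fun_def)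
  have greatest: "b \<le> m v" if "\<And>r. r \<in> C \<Longrightarrow> b \<le> r v" for b v
    unfolding m_def by (rule cINF_greatest) (use C that in auto)
  show "sublinear m"
    unfolding sublinear_def
  proof (intro conjI allI impI)
    fix v w
    have *: "m (v + w) \<le> r v + s w" if rs: "r \<in> C" "s \<in> C" for r s
    proof -
      obtain t where t: "t \<in> C" "t \<le> r" "t \<le> s"
        using chain[OF rs] rs by auto
      have "m (v + w) \<le> t v + t w"
        using lower[OF t(1), of "v + w"] sublinearD(1)[of t v w] C(2)[OF t(1)] by auto
      then show ?thesis using le_funD[OF t(2), of v] le_funD[OF t(3), of w] by linarith
    qed
    have "m (v + w) - r v \<le> m w" if "r \<in> C" for r
      using *[OF that] by (intro greatest) (smt (verit))
    then have "m (v + w) - m w \<le> m v"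
      by (intro greatest) (smt (verit))
    then show "m (v + w) \<le> m v + m w" by simp
  next
    have le: "c * m v \<le> m (c *\<^sub>R v)" if c: "c > 0" for c v
    proof (rule greatest)
      fix r assume r: "r \<in> C"
      then show "c * m v \<le> r (c *\<^sub>R v)"
        using lower[OF r, of v] c sublinearD(2)[of r c v] C(2)[OF r] by simp
    qed
    fix c :: real and v assume c: "c > 0"
    show "m (c *\<^sub>R v) = c * m v"
      using le[OF c, of v] le[of "1 / c" "c *\<^sub>R v"] c by (simp add: field_simps)
  qed
qed

text \<open>By Zorn there is a minimal sublinear functional below \<open>p\<close>. Minimality makes it invariant under
  all tilts, hence odd, and an odd sublinear functional is linear.\<close>

lemma sublinear_minorant_linear:
  assumes p: "sublinear p"
  obtains l where "linear l" "l \<le> p"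
proof -
  define P where "P = {r. sublinear r \<and> r \<le> p}"
  have "\<exists>m\<in>P. \<forall>r\<in>P. (\<lambda>r s. s \<le> r) m r \<longrightarrow> r = m"
  proof (rule predicate_Zorn)
    show "partial_order_on P (relation_of (\<lambda>r s. s \<le> r) P)"
      by (rule partial_order_on_relation_ofI) auto
    fix C assume "C \<in> Chains (relation_of (\<lambda>r s. s \<le> r) P)"
    then have CP: "C \<subseteq> P" and chain: "\<And>r s. r \<in> C \<Longrightarrow> s \<in> C \<Longrightarrow> r \<le> s \<or> s \<le> r"
      by (auto simp: Chains_def relation_of_def)
    show "\<exists>m\<in>P. \<forall>r\<in>C. m \<le> r"
    proof (cases "C = {}")
      case True
      then show ?thesis using p by (auto simp: P_def)
    next
      case False
      define m where "m = (\<lambda>v. INF r\<in>C. r v)"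
      have m: "sublinear m" "\<And>r. r \<in> C \<Longrightarrow> m \<le> r"
        unfolding m_def
        by (rule sublinear_chain_Inf[OF False _ chain p]; use CP in \<open>auto simp: P_def\<close>)+
      obtain r where "r \<in> C" using False by auto
      then have "m \<in> P" using m(1) m(2)[of r] CP by (auto simp: P_def)
      then show ?thesis using m(2) by auto
    qed
  qed
  then obtain m where m: "sublinear m" "m \<le> p"
    and minimal: "\<And>r. sublinear r \<Longrightarrow> r \<le> m \<Longrightarrow> r = m"
    unfolding P_def by (metis (no_types, lifting) mem_Collect_eq order_trans)
  have odd: "m (- x) = - m x" for x
    using minimal[OF sublinear_tilt tilt_le_self, OF m(1) m(1), of x] tilt_minus[OF m(1), of x] 
      sublinear_minus[OF m(1), of x]
    by simp
  have "linear m"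
  proof
    fix v w
    show "m (v + w) = m v + m w"
      using sublinearD(1)[OF m(1), of v w] sublinearD(1)[OF m(1), of "- v" "- w"]
        odd[of v] odd[of w] odd[of "v + w"] by simp
  next
    fix c v
    show "m (c *\<^sub>R v) = c *\<^sub>R m v"
      using sublinear_scaleR[OF m(1), of c v] sublinear_scaleR[OF m(1), of "- c" v]
        odd[of "c *\<^sub>R v"]
      by (cases "c \<ge> 0") auto
  qed
  then show ?thesis using m(2) that by blast
qed

text \<open>The Hahn--Banach theorem for one vector: a linear minorant of \<open>tilt p d\<close> lies below \<open>p\<close> and
  touches it at \<open>d\<close>. The bound by a multiple of the norm makes it continuous.\<close>

lemma sublinear_supporting_functional:
  fixes p :: "'a::real_normed_vector \<Rightarrow> real"
  assumes p: "sublinear p" and bound: "\<And>v. p v \<le> L * norm v"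
  obtains \<xi> :: "'a \<Rightarrow>\<^sub>L real" where "\<And>v. \<xi> v \<le> p v" "\<xi> d = p d"
proof -
  obtain l where l: "linear l" "l \<le> tilt p d"
    using sublinear_minorant_linear[OF sublinear_tilt[OF p]] by blast
  have lp: "l v \<le> p v" for v
    using le_funD[OF l(2), of v] le_funD[OF tilt_le_self[OF p, of d], of v] by linarith
  have "norm (l v) \<le> norm v * L" for v
    using lp[of v] lp[of "- v"] bound[of v] bound[of "- v"] linear_neg[OF l(1), of v]
    by (auto simp: algebra_simps)
  then have bl: "bounded_linear l"
    using l(1) by (intro bounded_linear_intro[where K=L]) (auto simp: linear_add linear_scale)
  have "l d = p d"
    using lp[of d] le_funD[OF l(2), of "- d"] tilt_minus[OF p, of d] linear_neg[OF l(1), of d]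
    by linarith
  then show ?thesis
    using that[of "Blinfun l"] lp bl by (simp add: bounded_linear_Blinfun_apply)
qed

section \<open>The Clarke directional derivative\<close>

definition clarke_quot :: "('a::real_normed_vector \<Rightarrow> real) \<Rightarrow> 'a \<Rightarrow> 'a \<times> real \<Rightarrow> real" where
  "clarke_quot j v = (\<lambda>(y, r). (j (y + r *\<^sub>R v) - j y) / r)"

abbreviation clarke_filter :: "'a::real_normed_vector \<Rightarrow> ('a \<times> real) filter" where
  "clarke_filter x \<equiv> nhds x \<times>\<^sub>F at_right 0"

lemma clarke_filter_bot: "clarke_filter x \<noteq> bot"
  by (simp add: prod_filter_eq_bot)

lemma clarke_deriv_quot:
  "clarke_deriv j x v = real_of_ereal (Limsup (clarke_filter x) (\<lambda>z. ereal (clarke_quot j v z)))"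
  by (simp add: clarke_deriv_def clarke_quot_def case_prod_beta')

lemma filterlim_clarke_base:
  fixes x :: "'a::real_normed_vector"
  shows "((\<lambda>z. fst z + snd z *\<^sub>R v) \<longlongrightarrow> x) (clarke_filter x)"
    and "filterlim snd (at_right 0) (clarke_filter x)"
    and "filterlim fst (nhds x) (clarke_filter x)"
proof -
  show fst: "filterlim fst (nhds x) (clarke_filter x)" 
    by (rule filterlim_fst)
  show snd: "filterlim snd (at_right 0) (clarke_filter x)" by (rule filterlim_snd)
  have "((snd :: 'a \<times> real \<Rightarrow> real) \<longlongrightarrow> 0) (clarke_filter x)"
    using snd by (simp add: filterlim_at)
  then have "((\<lambda>z. fst z + snd z *\<^sub>R v) \<longlongrightarrow> x + 0 *\<^sub>R v) (clarke_filter x)"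
    by (intro tendsto_intros fst)
  then show "((\<lambda>z. fst z + snd z *\<^sub>R v) \<longlongrightarrow> x) (clarke_filter x)" by simp
qed

text \<open>The difference quotients are bounded near the point, which makes the upper limit finite.\<close>

lemma eventually_clarke_quot_bound:
  fixes j :: "'a::real_normed_vector \<Rightarrow> real"
  assumes "locally_lipschitz j"
  obtains L where "\<And>v. \<forall>\<^sub>F z in clarke_filter x. \<bar>clarke_quot j v z\<bar> \<le> L * norm v"
proof -
  obtain r L where r: "r > 0" "L-lipschitz_on (ball x r) j"
    using assms unfolding locally_lipschitz_def by blast
  have "\<forall>\<^sub>F z in clarke_filter x. \<bar>clarke_quot j v z\<bar> \<le> L * norm v" for v
  proof -
    have 1: "\<forall>\<^sub>F z in clarke_filter x. fst z + snd z *\<^sub>R v \<in> ball x r"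
      by (rule topological_tendstoD[OF filterlim_clarke_base(1)]) (use r in auto)
    have 2: "\<forall>\<^sub>F z in clarke_filter x. fst z \<in> ball x r"
      by (rule topological_tendstoD[OF filterlim_clarke_base(3)]) (use r in auto)
    have 3: "\<forall>\<^sub>F z in clarke_filter x. snd z > 0"
      using filterlim_clarke_base(2)[of x] by (auto simp: filterlim_at elim: eventually_mono)
    show ?thesis
      using 1 2 3
    proof eventually_elim
      case (elim z)
      have "\<bar>j (fst z + snd z *\<^sub>R v) - j (fst z)\<bar> \<le> L * norm (snd z *\<^sub>R v)"
        using lipschitz_onD[OF r(2) elim(1,2)] by (simp add: dist_norm)
      then show ?case
        using elim(3) by (simp add: clarke_quot_def case_prod_beta' divide_simps mult_ac)
    qed
  qed
  then show ?thesis using that by blast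
qed

lemma clarke_Limsup_finite:
  fixes j :: "'a::real_normed_vector \<Rightarrow> real"
  assumes "locally_lipschitz j"
  shows "ereal (clarke_deriv j x v) = Limsup (clarke_filter x) (\<lambda>z. ereal (clarke_quot j v z))"
proof -
  obtain L where L: "\<forall>\<^sub>F z in clarke_filter x. \<bar>clarke_quot j v z\<bar> \<le> L * norm v"
    using eventually_clarke_quot_bound[OF assms] by metis
  have "Limsup (clarke_filter x) (\<lambda>z. ereal (clarke_quot j v z)) \<le> ereal (L * norm v)"
    by (rule Limsup_bounded, rule eventually_mono[OF L]) auto
  moreover have "ereal (- (L * norm v)) \<le> Limsup (clarke_filter x) (\<lambda>z. ereal (clarke_quot j v z))"
    by (rule le_Limsup[OF clarke_filter_bot], rule eventually_mono[OF L]) auto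
  ultimately show ?thesis
    unfolding clarke_deriv_quot
    by (cases "Limsup (clarke_filter x) (\<lambda>z. ereal (clarke_quot j v z))") auto
qed

text \<open>This lemma and the next one characterise the real number \<open>clarke_deriv j x v\<close> by eventual bounds
  on difference quotients; extended reals do not appear from there on.\<close>

lemma clarke_deriv_le:
  fixes j :: "'a::real_normed_vector \<Rightarrow> real"
  assumes "locally_lipschitz j" and "\<forall>\<^sub>F z in clarke_filter x. clarke_quot j v z \<le> c"
  shows "clarke_deriv j x v \<le> c"
proof -
  have "ereal (clarke_deriv j x v) \<le> ereal c"
    unfolding clarke_Limsup_finite[OF assms(1)]
    by (rule Limsup_bounded, rule eventually_mono[OF assms(2)]) auto
  then show ?thesis by simp
qed

lemma eventually_clarke_quot_less:
  fixes j :: "'a::real_normed_vector \<Rightarrow> real"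
  assumes "locally_lipschitz j" and "clarke_deriv j x v < c"
  shows "\<forall>\<^sub>F z in clarke_filter x. clarke_quot j v z < c"
proof -
  have "Limsup (clarke_filter x) (\<lambda>z. ereal (clarke_quot j v z)) < ereal c"
    using assms by (simp flip: clarke_Limsup_finite)
  from Limsup_lessD[OF this] show ?thesis by simp
qed

text \<open>The quotient in direction \<open>v + w\<close> is the sum of the quotients in direction \<open>v\<close> at \<open>y\<close> and in
  direction \<open>w\<close> at \<open>y + r v\<close>; the quotient in direction \<open>c v\<close> is \<open>c\<close> times the one in direction \<open>v\<close>
  with step \<open>c r\<close>. Both changes of variables preserve the filter over which the limit is taken.\<close>

lemma sublinear_clarke_deriv:
  fixes j :: "'a::real_normed_vector \<Rightarrow> real"
  assumes j: "locally_lipschitz j"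
  shows "sublinear (clarke_deriv j x)"
  unfolding sublinear_def
proof (intro conjI allI impI)
  fix v w
  show "clarke_deriv j x (v + w) \<le> clarke_deriv j x v + clarke_deriv j x w"
  proof (rule field_le_epsilon)
    fix e :: real assume e: "e > 0"
    have 1: "\<forall>\<^sub>F z in clarke_filter x. clarke_quot j v z < clarke_deriv j x v + e / 2"
      using e by (intro eventually_clarke_quot_less j) auto
    have "\<forall>\<^sub>F z in clarke_filter x. clarke_quot j w z < clarke_deriv j x w + e / 2"
      using e by (intro eventually_clarke_quot_less j) auto
    moreover have "filterlim (\<lambda>z. (fst z + snd z *\<^sub>R v, snd z)) (clarke_filter x) (clarke_filter x)"
      by (intro filterlim_Pair filterlim_clarke_base)
    ultimately have 2: "\<forall>\<^sub>F z in clarke_filter x.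
        clarke_quot j w (fst z + snd z *\<^sub>R v, snd z) < clarke_deriv j x w + e / 2"
      by (auto simp: filterlim_iff)
    have "\<forall>\<^sub>F z in clarke_filter x.
      clarke_quot j (v + w) z \<le> clarke_deriv j x v + clarke_deriv j x w + e"
      using 1 2
    proof eventually_elim
      case (elim z)
      have "clarke_quot j (v + w) z = clarke_quot j v z + clarke_quot j w (fst z + snd z *\<^sub>R v, snd z)"
        by (simp add: clarke_quot_def case_prod_beta' add_divide_distrib[symmetric] algebra_simps)
      then show ?case using elim by linarith
    qed
    then show "clarke_deriv j x (v + w) \<le> clarke_deriv j x v + clarke_deriv j x w + e"
      by (rule clarke_deriv_le[OF j])
  qed
next
  have le: "clarke_deriv j x (c *\<^sub>R v) \<le> c * clarke_deriv j x v" if c: "c > 0" for c v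
  proof (rule field_le_epsilon)
    fix e :: real assume e: "e > 0"
    have "\<forall>\<^sub>F z in clarke_filter x. clarke_quot j v z < clarke_deriv j x v + e / c"
      using e c by (intro eventually_clarke_quot_less j) auto
    moreover have "filterlim (\<lambda>z::'a\<times>real. (fst z, c * snd z)) (clarke_filter x) (clarke_filter x)"
    proof (intro filterlim_Pair filterlim_clarke_base)
      have s: "filterlim snd (at_right 0) (clarke_filter x)" by (rule filterlim_clarke_base)
      then have "((\<lambda>z. c * snd z) \<longlongrightarrow> c * 0) (clarke_filter x)"
        by (intro tendsto_intros) (simp add: filterlim_at)
      then show "filterlim (\<lambda>z. c * snd z) (at_right 0) (clarke_filter x)"
        using s c by (auto simp: filterlim_at zero_less_mult_iff elim!: eventually_mono)
    qed
    ultimately have "\<forall>\<^sub>F z in clarke_filter x.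
        clarke_quot j v (fst z, c * snd z) < clarke_deriv j x v + e / c"
      by (auto simp: filterlim_iff)
    then have "\<forall>\<^sub>F z in clarke_filter x. clarke_quot j (c *\<^sub>R v) z \<le> c * clarke_deriv j x v + e"
    proof eventually_elim
      case (elim z)
      have "clarke_quot j (c *\<^sub>R v) z = c * clarke_quot j v (fst z, c * snd z)"
        using c by (simp add: clarke_quot_def case_prod_beta' mult.commute)
      also have "\<dots> \<le> c * (clarke_deriv j x v + e / c)"
        using elim c by (intro mult_left_mono) auto
      finally show ?case using c by (simp add: distrib_left)
    qed
    then show "clarke_deriv j x (c *\<^sub>R v) \<le> c * clarke_deriv j x v + e"
      by (rule clarke_deriv_le[OF j])
  qed
  fix c :: real and v assume c: "c > 0"
  show "clarke_deriv j x (c *\<^sub>R v) = c * clarke_deriv j x v"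
    using le[OF c, of v] le[of "1 / c" "c *\<^sub>R v"] c by (simp add: field_simps)
qed

text \<open>A bound on subgradients says something about the Clarke derivative only if there is a
  subgradient that attains it in direction \<open>d\<close>; the supporting functional is one.\<close>

lemma clarke_deriv_growth:
  fixes j :: "'a::real_normed_vector \<Rightarrow> real"
  assumes j: "locally_lipschitz j"
    and growth: "\<And>\<xi>. \<xi> \<in> clarke_subdiff j z \<Longrightarrow> norm \<xi> \<le> b"
  shows "clarke_deriv j z d \<le> b * norm d"
proof -
  obtain L where L: "\<And>v. \<forall>\<^sub>F y in clarke_filter z. \<bar>clarke_quot j v y\<bar> \<le> L * norm v"
    using eventually_clarke_quot_bound[OF j] by metis
  have "clarke_deriv j z v \<le> L * norm v" for v
    by (rule clarke_deriv_le[OF j], rule eventually_mono[OF L[of v]]) auto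
  then obtain \<xi> :: "'a \<Rightarrow>\<^sub>L real" where \<xi>: "\<And>v. \<xi> v \<le> clarke_deriv j z v" "\<xi> d = clarke_deriv j z d"
    using sublinear_supporting_functional[OF sublinear_clarke_deriv[OF j]] by metis
  have "\<xi> d \<le> norm \<xi> * norm d" using norm_blinfun[of \<xi> d] by simp
  also have "\<dots> \<le> b * norm d"
    using growth[of \<xi>] \<xi>(1) by (intro mult_right_mono) (auto simp: clarke_subdiff_def)
  finally show ?thesis using \<xi>(2) by simp
qed

section \<open>Smooth bumps and mollifiers\<close>

text \<open>These functions are flat at \<open>0\<close>, and differentiation only changes the polynomial. This closure
  is what gives smoothness of all orders without computing higher derivatives.\<close>

definition flat :: "real poly \<Rightarrow> real \<Rightarrow> real" where
  "flat p x = (if x > 0 then poly p (1 / x) * exp (- 1 / x) else 0)"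

lemma poly_exp_neg_tendsto_0: "((\<lambda>y. poly p y * exp (- y)) \<longlongrightarrow> 0) (at_top :: real filter)"
proof -
  have "((\<lambda>y. \<Sum>i\<le>degree p. coeff p i * (y ^ i / exp y)) \<longlongrightarrow> (\<Sum>i\<le>degree p. coeff p i * 0)) at_top"
    by (intro tendsto_intros tendsto_power_div_exp_0)
  then show ?thesis
    by (simp add: poly_altdef exp_minus field_simps sum_divide_distrib sum_distrib_right)
qed

lemma flat_has_derivative:
  "(flat p has_real_derivative flat ([:0, 0, 1:] * (p - pderiv p)) x) (at x)"
proof -
  consider "x > 0" | "x < 0" | "x = 0" by linarith
  then show ?thesis
  proof cases
    case 1
    have "((\<lambda>x. poly p (1 / x) * exp (- 1 / x)) has_real_derivative
        flat ([:0, 0, 1:] * (p - pderiv p)) x) (at x)"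
      using 1 by (auto intro!: derivative_eq_intros DERIV_chain2[OF poly_DERIV]
          simp: flat_def field_simps power2_eq_square)
    then show ?thesis
      by (rule has_field_derivative_transform_within_open[of _ _ _ "{0<..}"])
        (use 1 in \<open>auto simp: flat_def\<close>)
  next
    case 2
    have "((\<lambda>x. 0) has_real_derivative 0) (at x)" by simp
    then have "(flat p has_real_derivative 0) (at x)"
      by (rule has_field_derivative_transform_within_open[of _ _ _ "{..<0}"])
        (use 2 in \<open>auto simp: flat_def\<close>)
    then show ?thesis using 2 by (simp add: flat_def)
  next
    case 3
    have "((\<lambda>h. poly (pCons 0 p) (inverse h) * exp (- inverse h)) \<longlongrightarrow> 0) (at_right 0)"
      by (rule filterlim_compose[OF poly_exp_neg_tendsto_0 filterlim_inverse_at_top_right])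
    moreover have "\<forall>\<^sub>F h in at_right 0.
        poly (pCons 0 p) (inverse h) * exp (- inverse h) = (flat p h - flat p 0) / (h - 0)"
      using eventually_at_right_less[of "0::real"]
      by eventually_elim (auto simp: flat_def field_simps)
    ultimately have right: "((\<lambda>h. (flat p h - flat p 0) / (h - 0)) \<longlongrightarrow> 0) (at_right 0)"
      by (rule Lim_transform_eventually)
    have "\<forall>\<^sub>F h in at_left (0::real). 0 = (flat p h - flat p 0) / (h - 0)"
      by (auto simp: flat_def eventually_at_filter)
    then have left: "((\<lambda>h. (flat p h - flat p 0) / (h - 0)) \<longlongrightarrow> 0) (at_left 0)"
      by (rule Lim_transform_eventually[OF tendsto_const])
    show ?thesis
      using filterlim_split_at[OF left right] 3 by (simp add: has_field_derivative_iff flat_def)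
  qed
qed

text \<open>A product of two flat functions with \<open>b > 0 > d\<close> is a bump with compact support. The derivative of
  such a product is a sum of two products of the same form, so the class of sums is closed under
  differentiation, and membership implies smoothness.\<close>

inductive bump_sum :: "(real \<Rightarrow> real) \<Rightarrow> bool" where
  bump: "bump_sum (\<lambda>x. flat p (a + b * x) * flat r (c + d * x))"
| add: "bump_sum g \<Longrightarrow> bump_sum h \<Longrightarrow> bump_sum (\<lambda>x. g x + h x)"

lemma flat_smult: "flat (smult c p) x = c * flat p x"
  by (simp add: flat_def)

lemma bump_sum_deriv:
  assumes "bump_sum g"
  shows "\<exists>g'. bump_sum g' \<and> (\<forall>x. (g has_real_derivative g' x) (at x))"
  using assms
proof induction
  case (bump p a b r c d)
  define D where "D = (\<lambda>p :: real poly. [:0, 0, 1:] * (p - pderiv p))"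
  have chain: "((\<lambda>x. flat p (a + b * x)) has_real_derivative flat (smult b (D p)) (a + b * x)) (at x)"
    for p a b x
    unfolding flat_smult D_def
    by (rule DERIV_cong[OF DERIV_chain2[OF flat_has_derivative]]) (auto intro!: derivative_eq_intros)
  have deriv: "((\<lambda>x. flat p (a + b * x) * flat r (c + d * x)) has_real_derivative
      flat (smult b (D p)) (a + b * x) * flat r (c + d * x)
      + flat p (a + b * x) * flat (smult d (D r)) (c + d * x)) (at x)" for x
    using DERIV_mult'[OF chain[of p a b x] chain[of r c d x]] by (simp add: add.commute)
  show ?case
    by (intro exI[of _ "\<lambda>x. flat (smult b (D p)) (a + b * x) * flat r (c + d * x)
      + flat p (a + b * x) * flat (smult d (D r)) (c + d * x)"] conjI allI deriv bump_sum.intros)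
next
  case (add g h)
  then show ?case by (blast intro: bump_sum.add DERIV_add)
qed

lemma bump_sum_scale_shift:
  assumes "bump_sum g"
  shows "bump_sum (\<lambda>x. k * g (x - s))"
  using assms
proof induction
  case (bump p a b r c d)
  have "(\<lambda>x. k * (flat p (a + b * (x - s)) * flat r (c + d * (x - s))))
      = (\<lambda>x. flat (smult k p) ((a - b * s) + b * x) * flat r ((c - d * s) + d * x))"
    by (auto simp: flat_smult algebra_simps)
  then show ?case using bump_sum.bump by metis
next
  case (add g h)
  then show ?case by (simp add: distrib_left bump_sum.add)
qed

definition smooth_fun :: "(real \<Rightarrow> real) \<Rightarrow> bool" where
  "smooth_fun f \<longleftrightarrow> (\<forall>n. ((deriv ^^ n) f) differentiable_on UNIV)"

lemma deriv_fun_eq: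
  assumes "\<And>x. (g has_real_derivative g' x) (at x)"
  shows "deriv g = g'"
  using assms by (auto intro: DERIV_imp_deriv)

lemma differentiable_on_UNIV_DERIV:
  assumes "\<And>x. (g has_real_derivative g' x) (at x)"
  shows "g differentiable_on UNIV"
  using assms unfolding differentiable_on_def
  by (auto simp: real_differentiable_def)

lemma smooth_bump_sum:
  assumes "bump_sum g"
  shows "smooth_fun g"
  unfolding smooth_fun_def
proof
  fix n
  have "bump_sum ((deriv ^^ n) g)"
  proof (induction n)
    case 0
    then show ?case using assms by simp
  next
    case (Suc n)
    obtain g' where g': "bump_sum g'" "\<And>x. (((deriv ^^ n) g) has_real_derivative g' x) (at x)"
      using bump_sum_deriv[OF Suc] by blast
    then show ?case using deriv_fun_eq[OF g'(2)] by simp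
  qed
  then show "(deriv ^^ n) g differentiable_on UNIV"
    using bump_sum_deriv by (blast intro: differentiable_on_UNIV_DERIV)
qed

lemma smooth_primitive:
  assumes d: "\<And>x. (g has_real_derivative g' x) (at x)" and "smooth_fun g'"
  shows "smooth_fun g"
  unfolding smooth_fun_def
proof
  fix n
  show "(deriv ^^ n) g differentiable_on UNIV"
    using assms(2) differentiable_on_UNIV_DERIV[of g g', OF d] 
    by (cases n) (simp_all add: smooth_fun_def funpow_swap1 deriv_fun_eq[OF d] del: funpow.simps(2) add: funpow_Suc_right)
qed

text \<open>The primitives of a mollifier \<open>\<rho>\<close> are a smoothed step \<open>S\<close> and a smoothed ramp \<open>E\<close>.
  Differences of shifted steps and, because \<open>E\<close> is affine to the right of \<open>\<epsilon>\<close>, symmetric second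
  differences of shifted ramps have compact support, and
  their first and second derivatives, respectively, are combinations of shifted \<open>\<rho>\<close>. They are the
  test functions used below.\<close>

definition mollifier :: "real \<Rightarrow> (real \<Rightarrow> real) \<Rightarrow> (real \<Rightarrow> real) \<Rightarrow> (real \<Rightarrow> real) \<Rightarrow> bool" where
  "mollifier \<epsilon> \<rho> S E \<longleftrightarrow>
     bump_sum \<rho> \<and> (\<forall>x. \<rho> x \<ge> 0) \<and> (\<forall>x. \<bar>x\<bar> \<ge> \<epsilon> \<longrightarrow> \<rho> x = 0) \<and>
     (\<forall>x. (S has_real_derivative \<rho> x) (at x)) \<and> (\<forall>x. x \<le> - \<epsilon> \<longrightarrow> S x = 0) \<and> (\<forall>x\<ge>\<epsilon>. S x = 1) \<and>
     (\<forall>x. (E has_real_derivative S x) (at x)) \<and> (\<forall>x. x \<le> - \<epsilon> \<longrightarrow> E x = 0) \<and>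
     (\<exists>c. \<forall>x\<ge>\<epsilon>. E x = x + c)"

lemma primitive_vanishing_at:
  fixes g :: "real \<Rightarrow> real"
  assumes "continuous_on UNIV g"
  obtains G where "\<And>x. (G has_real_derivative g x) (at x)" "G a = 0"
proof -
  have "\<exists>F. \<forall>x :: real. -\<infinity> < ereal x \<longrightarrow> ereal x < \<infinity> \<longrightarrow> (F has_vector_derivative g x) (at x)"
    by (rule einterval_antiderivative) (use assms in \<open>auto simp: continuous_on_eq_continuous_at\<close>)
  then obtain F where F: "\<And>x. (F has_real_derivative g x) (at x)"
    by (auto simp: has_real_derivative_iff_has_vector_derivative)
  have "((\<lambda>x. F x - F a) has_real_derivative g x) (at x)" for x
    using F by (auto intro!: derivative_eq_intros)
  then show ?thesis using that[of "\<lambda>x. F x - F a"] by simp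
qed

lemma DERIV_const_interval:
  fixes G :: "real \<Rightarrow> real"
  assumes "\<And>x. (G has_real_derivative g x) (at x)" "\<And>x. a < x \<Longrightarrow> x < b \<Longrightarrow> g x = c" "a \<le> b"
  shows "G b = G a + (b - a) * c"
proof (cases "a = b")
  case False
  then obtain z where "a < z" "z < b" "G b - G a = (b - a) * g z"
    using MVT2[of a b G g] assms by auto
  then show ?thesis using assms(2) by simp
qed simp

lemma mollifier_exists:
  assumes e: "\<epsilon> > 0"
  obtains \<rho> S E where "mollifier \<epsilon> \<rho> S E"
proof -
  define \<rho>0 where "\<rho>0 = (\<lambda>x. flat 1 (\<epsilon> + 1 * x) * flat 1 (\<epsilon> + (- 1) * x))"
  have b0: "bump_sum \<rho>0" unfolding \<rho>0_def by (rule bump_sum.bump)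
  have supp0: "\<rho>0 x = 0" if "\<bar>x\<bar> \<ge> \<epsilon>" for x
    using that by (auto simp: \<rho>0_def flat_def)
  have pos0: "\<rho>0 x > 0" if "- \<epsilon> < x" "x < \<epsilon>" for x
    using that by (auto simp: \<rho>0_def flat_def)
  have cont0: "continuous_on UNIV \<rho>0"
    using bump_sum_deriv[OF b0] by (metis DERIV_isCont continuous_at_imp_continuous_on)
  obtain S0 where S0: "\<And>x. (S0 has_real_derivative \<rho>0 x) (at x)" "S0 (- \<epsilon>) = 0"
    using primitive_vanishing_at[OF cont0] by metis
  obtain z where z: "- \<epsilon> < z" "z < \<epsilon>" "S0 \<epsilon> - S0 (- \<epsilon>) = (\<epsilon> - (- \<epsilon>)) * \<rho>0 z"
    using MVT2[of "- \<epsilon>" \<epsilon> S0 \<rho>0] S0 e by auto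
  define I where "I = S0 \<epsilon>"
  have I: "I > 0" using z pos0[of z] S0(2) e by (simp add: I_def)
  define \<rho> where "\<rho> = (\<lambda>x. (1 / I) * \<rho>0 (x - 0))"
  define S where "S = (\<lambda>x. S0 x / I)"
  have \<rho>: "bump_sum \<rho>" unfolding \<rho>_def by (rule bump_sum_scale_shift[OF b0])
  have supp: "\<rho> x = 0" if "\<bar>x\<bar> \<ge> \<epsilon>" for x using supp0[OF that] by (simp add: \<rho>_def)
  have nonneg: "\<rho> x \<ge> 0" for x
    using supp0[of x] pos0[of x] I by (cases "\<bar>x\<bar> \<ge> \<epsilon>") (auto simp: \<rho>_def abs_less_iff not_le less_imp_le)
  have S: "(S has_real_derivative \<rho> x) (at x)" for x
    unfolding S_def \<rho>_def using DERIV_cdivide[OF S0(1)[of x], of I] by simp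
  have Sl: "S x = 0" if "x \<le> - \<epsilon>" for x
    using DERIV_const_interval[OF S _ that, of 0] supp S0(2) by (auto simp: S_def)
  have Sr: "S x = 1" if "x \<ge> \<epsilon>" for x
    using DERIV_const_interval[OF S _ that, of 0] supp I by (auto simp: S_def I_def)
  have "continuous_on UNIV S"
    using S by (metis DERIV_isCont continuous_at_imp_continuous_on)
  then obtain E where E: "\<And>x. (E has_real_derivative S x) (at x)" "E (- \<epsilon>) = 0"
    using primitive_vanishing_at by metis
  have El: "E x = 0" if "x \<le> - \<epsilon>" for x
    using DERIV_const_interval[OF E(1) _ that, of 0] Sl E(2) by auto
  have Er: "E x = x + (E \<epsilon> - \<epsilon>)" if "x \<ge> \<epsilon>" for x
    using DERIV_const_interval[OF E(1) _ that, of 1] Sr by auto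
  have "mollifier \<epsilon> \<rho> S E"
    unfolding mollifier_def using \<rho> nonneg supp S Sl Sr E El Er by blast
  then show ?thesis using that by blast
qed

lemma mollifier_step_bounds:
  assumes "mollifier \<epsilon> \<rho> S E" "\<epsilon> > 0"
  shows "0 \<le> S x" "S x \<le> 1" and "x \<le> y \<Longrightarrow> E x \<le> E y" "x \<le> y \<Longrightarrow> E y \<le> E x + (y - x)"
proof -
  note m = assms(1)[unfolded mollifier_def]
  have mono: "S x \<le> S y" if "x \<le> y" for x y
    by (rule DERIV_nonneg_imp_nondecreasing[OF that]) (use m in blast)
  have S: "0 \<le> S x" "S x \<le> 1" for x
    using mono[of "min x (- \<epsilon>)" x] mono[of x "max x \<epsilon>"] m by auto
  show "0 \<le> S x" "S x \<le> 1" by (rule S)+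
  show "E x \<le> E y" if "x \<le> y"
    by (rule DERIV_nonneg_imp_nondecreasing[OF that]) (use m S in blast)
  show "E y \<le> E x + (y - x)" if xy: "x \<le> y"
  proof -
    have "x - E x \<le> y - E y"
    proof (rule DERIV_nonneg_imp_nondecreasing[OF xy])
      fix z
      have "((\<lambda>x. x - E x) has_real_derivative 1 - S z) (at z)"
        using m by (auto intro!: derivative_eq_intros)
      then show "\<exists>y. ((\<lambda>x. x - E x) has_real_derivative y) (at z) \<and> 0 \<le> y"
        using S(2)[of z] by auto
    qed
    then show ?thesis by simp
  qed
qed

lemma continuous_on_mollifier:
  assumes "mollifier \<epsilon> \<rho> S E"
  shows "continuous_on A (\<lambda>s. \<rho> (s - a))"
  using bump_sum_deriv[OF bump_sum_scale_shift[of \<rho> 1 a]] assms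
  by (metis (no_types, lifting) DERIV_isCont continuous_at_imp_continuous_on mult_1 ext mollifier_def)

lemma mollifier_approx:
  fixes u :: "real \<Rightarrow> 'a::banach"
  assumes u: "continuous_on {0..T} u" and a: "0 < a" "a < T" and d: "\<delta> > 0"
  obtains \<epsilon>0 where "\<epsilon>0 > 0"
    "\<And>\<epsilon> \<rho> S E. 0 < \<epsilon> \<Longrightarrow> \<epsilon> < \<epsilon>0 \<Longrightarrow> mollifier \<epsilon> \<rho> S E \<Longrightarrow>
       norm (integral {0..T} (\<lambda>s. \<rho> (s - a) *\<^sub>R u s) - u a) \<le> \<delta>"
proof -
  obtain r where r: "r > 0" "\<And>s. s \<in> {0..T} \<Longrightarrow> dist s a < r \<Longrightarrow> dist (u s) (u a) < \<delta>"
    using u a d unfolding continuous_on_iff by (metis atLeastAtMost_iff less_imp_le)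
  define \<epsilon>0 where "\<epsilon>0 = min r (min a (T - a))"
  have e0: "\<epsilon>0 > 0" using r a by (simp add: \<epsilon>0_def)
  show ?thesis
  proof (rule that[OF e0])
    fix \<epsilon> \<rho> S E
    assume e: "0 < \<epsilon>" "\<epsilon> < \<epsilon>0" and m: "mollifier \<epsilon> \<rho> S E"
    then have \<rho>: "\<And>x. \<rho> x \<ge> 0" "\<And>x. \<bar>x\<bar> \<ge> \<epsilon> \<Longrightarrow> \<rho> x = 0"
      and S: "\<And>x. (S has_real_derivative \<rho> x) (at x)" "\<And>x. x \<le> - \<epsilon> \<Longrightarrow> S x = 0" "\<And>x. x \<ge> \<epsilon> \<Longrightarrow> S x = 1"
      by (auto simp: mollifier_def)
    have "((\<lambda>s. \<rho> (s - a)) has_integral S (T - a) - S (0 - a)) {0..T}"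
    proof (rule fundamental_theorem_of_calculus)
      show "0 \<le> T" using a by simp
      fix x
      have "((\<lambda>s. S (s - a)) has_real_derivative \<rho> (x - a)) (at x)"
        by (rule DERIV_cong[OF DERIV_chain2[OF S(1)]]) (auto intro!: derivative_eq_intros)
      then show "((\<lambda>s. S (s - a)) has_vector_derivative \<rho> (x - a)) (at x within {0..T})"
        by (simp add: has_real_derivative_iff_has_vector_derivative has_vector_derivative_at_within)
    qed
    moreover have "S (T - a) = 1" "S (0 - a) = 0"
      using S e by (auto simp: \<epsilon>0_def)
    ultimately have I: "((\<lambda>s. \<rho> (s - a)) has_integral 1) {0..T}" by simp
    note cont = continuous_on_mollifier[OF m, of "{0..T}" a]
    have 1: "(\<lambda>s. \<rho> (s - a) *\<^sub>R u s) integrable_on {0..T}"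
      by (intro integrable_continuous_real continuous_intros u cont)
    have 2: "((\<lambda>s. \<rho> (s - a) *\<^sub>R u a) has_integral (1 *\<^sub>R u a)) {0..T}"
      by (rule has_integral_scaleR_left[OF I])
    have "integral {0..T} (\<lambda>s. \<rho> (s - a) *\<^sub>R u s) - u a
        = integral {0..T} (\<lambda>s. \<rho> (s - a) *\<^sub>R u s - \<rho> (s - a) *\<^sub>R u a)"
      using Henstock_Kurzweil_Integration.integral_diff[OF 1 has_integral_integrable[OF 2]]
        integral_unique[OF 2] by simp
    also have "norm \<dots> \<le> integral {0..T} (\<lambda>s. \<rho> (s - a) * \<delta>)"
    proof (rule Henstock_Kurzweil_Integration.integral_norm_bound_integral)
      show "(\<lambda>s. \<rho> (s - a) *\<^sub>R u s - \<rho> (s - a) *\<^sub>R u a) integrable_on {0..T}"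
        using Henstock_Kurzweil_Integration.integrable_diff[OF 1 has_integral_integrable[OF 2]] .
      show "(\<lambda>s. \<rho> (s - a) * \<delta>) integrable_on {0..T}"
        by (intro integrable_continuous_real continuous_intros cont)
      fix s assume s: "s \<in> {0..T}"
      show "norm (\<rho> (s - a) *\<^sub>R u s - \<rho> (s - a) *\<^sub>R u a) \<le> \<rho> (s - a) * \<delta>"
      proof (cases "\<bar>s - a\<bar> \<ge> \<epsilon>")
        case False
        then have "norm (u s - u a) \<le> \<delta>"
          using r(2)[OF s] e by (auto simp: \<epsilon>0_def dist_norm)
        then show ?thesis
          using \<rho>(1) by (simp flip: scaleR_diff_right add: mult_left_mono)
      qed (simp add: \<rho>(2))
    qed
    also have "\<dots> = \<delta>"
      using integral_unique[OF has_integral_mult_left[OF I, of \<delta>]] by simp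
    finally show "norm (integral {0..T} (\<lambda>s. \<rho> (s - a) *\<^sub>R u s) - u a) \<le> \<delta>" .
  qed
qed

section \<open>Differences of functions with bounded weak derivatives\<close>

lemma test_functionI:
  assumes "smooth_fun \<psi>" "0 < c" "d < T" "\<And>t. t \<le> c \<or> d \<le> t \<Longrightarrow> \<psi> t = 0"
  shows "test_function T \<psi>"
  unfolding test_function_def
proof (intro conjI exI[of _ "{c..d}"])
  show "\<forall>n. (deriv ^^ n) \<psi> differentiable_on UNIV" using assms(1) by (simp add: smooth_fun_def)
  show "\<forall>t. t \<notin> {c..d} \<longrightarrow> \<psi> t = 0" using assms(4) by auto
qed (use assms(2,3) in auto)

text \<open>The bound on \<open>g'\<close> is turned into a bound on a functional of \<open>g\<close>. If \<open>\<psi> g'\<close> fails to be integrable,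
  the right-hand side of the weak identity is \<open>0\<close> by convention and the bound holds trivially.\<close>

lemma weak_deriv_norm_bound:
  fixes g :: "real \<Rightarrow> 'a::banach"
  assumes weak: "weak_deriv T g g'" and bound: "AE t in lebesgue_on {0<..<T}. norm (g' t) \<le> M"
    and smooth: "smooth_fun \<psi>"
    and cd: "0 < c" "c \<le> d" "d < T" and supp: "\<And>t. t \<le> c \<or> d \<le> t \<Longrightarrow> \<psi> t = 0"
    and K: "\<And>t. \<bar>\<psi> t\<bar> \<le> K" and M: "M \<ge> 0"
  shows "norm (integral {0..T} (\<lambda>t. deriv \<psi> t *\<^sub>R g t)) \<le> M * K * (d - c)"
proof -
  have K0: "K \<ge> 0" using K[of 0] by linarith
  have "integral {0..T} (\<lambda>t. deriv \<psi> t *\<^sub>R g t) = - integral {0..T} (\<lambda>t. \<psi> t *\<^sub>R g' t)"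
    using weak test_functionI[OF smooth cd(1,3) supp] by (simp add: weak_deriv_def)
  also have "norm \<dots> \<le> M * K * (d - c)"
  proof (cases "(\<lambda>t. \<psi> t *\<^sub>R g' t) integrable_on {0..T}")
    case False
    then show ?thesis using M K0 cd by (simp add: not_integrable_integral)
  next
    case True
    obtain Z where Z: "negligible Z" "\<And>t. t \<in> {0<..<T} \<Longrightarrow> t \<notin> Z \<Longrightarrow> norm (g' t) \<le> M"
    proof -
      have "AE t in lebesgue. t \<in> {0<..<T} \<longrightarrow> norm (g' t) \<le> M"
        using bound by (subst (asm) AE_restrict_space_iff) auto
      then obtain Z where "{t \<in> space lebesgue. \<not> (t \<in> {0<..<T} \<longrightarrow> norm (g' t) \<le> M)} \<subseteq> Z"
          "emeasure lebesgue Z = 0" "Z \<in> sets lebesgue"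
        by (rule AE_E)
      then show ?thesis using that[of Z] by (auto simp: negligible_iff_null_sets null_sets_def)
    qed
    define F where "F = (\<lambda>t. if t \<in> Z then 0 else \<psi> t *\<^sub>R g' t)"
    have F: "F integrable_on {0..T}"
      by (rule integrable_spike[OF True Z(1)]) (auto simp: F_def)
    have "integral {0..T} (\<lambda>t. \<psi> t *\<^sub>R g' t) = integral {0..T} F"
      by (rule integral_spike[OF Z(1)]) (auto simp: F_def)
    also have "norm \<dots> \<le> integral {0..T} (\<lambda>t. if t \<in> {c..d} then M * K else 0)"
    proof (rule Henstock_Kurzweil_Integration.integral_norm_bound_integral[OF F])
      have "(\<lambda>t. M * K) integrable_on {c..d}" by (intro integrable_continuous_real continuous_intros)
      then show "(\<lambda>t. if t \<in> {c..d} then M * K else 0) integrable_on {0..T}"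
        unfolding integrable_on_def using cd by (subst has_integral_restrict) auto
      fix t :: real
      assume "t \<in> {0..T}"
      show "norm (F t) \<le> (if t \<in> {c..d} then M * K else 0)"
      proof (cases "t \<in> {c..d}")
        case True
        then have "norm (F t) \<le> \<bar>\<psi> t\<bar> * M"
          using Z(2)[of t] cd M by (auto simp: F_def intro: mult_left_mono)
        also have "\<dots> \<le> K * M" using K M by (intro mult_right_mono) auto
        finally show ?thesis using True by (simp add: mult.commute)
      next
        case False
        then show ?thesis using supp[of t] by (auto simp: F_def)
      qed
    qed
    also have "\<dots> = M * K * (d - c)"
      using cd by (intro integral_unique, subst has_integral_restrict)
        (auto intro!: has_integral_const_real[of "M * K" c d, THEN has_integral_eq_rhs])
    finally show ?thesis by simp
  qed
  finally show ?thesis .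
qed

lemma integrable_mollifier:
  fixes u :: "real \<Rightarrow> 'a::banach"
  assumes "mollifier \<epsilon> \<rho> S E" "continuous_on {0..T} u"
  shows "(\<lambda>s. \<rho> (s - a) *\<^sub>R u s) integrable_on {0..T}"
  by (intro integrable_continuous_real continuous_intros continuous_on_mollifier[OF assms(1)] assms(2))

lemma smooth_fun_mollifier_comb:
  assumes m: "mollifier \<epsilon> \<rho> S E"
  shows "smooth_fun (\<lambda>x. p * \<rho> (x - a) + q * \<rho> (x - b) + r * \<rho> (x - c))"
    and "smooth_fun (\<lambda>x. p * S (x - a) + q * S (x - b) + r * S (x - c))"
    and "smooth_fun (\<lambda>x. p * E (x - a) + q * E (x - b) + r * E (x - c))"
    and "deriv (\<lambda>x. p * S (x - a) + q * S (x - b) + r * S (x - c))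
        = (\<lambda>x. p * \<rho> (x - a) + q * \<rho> (x - b) + r * \<rho> (x - c))"
    and "deriv (\<lambda>x. p * E (x - a) + q * E (x - b) + r * E (x - c))
        = (\<lambda>x. p * S (x - a) + q * S (x - b) + r * S (x - c))"
proof -
  have "bump_sum \<rho>" and S: "(S has_real_derivative \<rho> x) (at x)" and E: "(E has_real_derivative S x) (at x)" for x
    using m by (auto simp: mollifier_def)
  then show 1: "smooth_fun (\<lambda>x. p * \<rho> (x - a) + q * \<rho> (x - b) + r * \<rho> (x - c))"
    by (intro smooth_bump_sum bump_sum.add bump_sum_scale_shift)
  have shift: "((\<lambda>x. G (x - s)) has_real_derivative G' (x - s)) (at x)"
    if "\<And>x. (G has_real_derivative G' x) (at x)" for G G' :: "real \<Rightarrow> real" and s x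
    by (rule DERIV_cong[OF DERIV_chain2[OF that]]) (auto intro!: derivative_eq_intros)
  have dS: "((\<lambda>x. p * S (x - a) + q * S (x - b) + r * S (x - c)) has_real_derivative
      p * \<rho> (x - a) + q * \<rho> (x - b) + r * \<rho> (x - c)) (at x)" for x
    by (intro DERIV_add DERIV_cmult shift S)
  show 2: "smooth_fun (\<lambda>x. p * S (x - a) + q * S (x - b) + r * S (x - c))"
    by (rule smooth_primitive[OF dS 1])
  have dE: "((\<lambda>x. p * E (x - a) + q * E (x - b) + r * E (x - c)) has_real_derivative
      p * S (x - a) + q * S (x - b) + r * S (x - c)) (at x)" for x
    by (intro DERIV_add DERIV_cmult shift E)
  show "smooth_fun (\<lambda>x. p * E (x - a) + q * E (x - b) + r * E (x - c))"
    by (rule smooth_primitive[OF dE 2])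
  show "deriv (\<lambda>x. p * S (x - a) + q * S (x - b) + r * S (x - c))
        = (\<lambda>x. p * \<rho> (x - a) + q * \<rho> (x - b) + r * \<rho> (x - c))"
    by (rule deriv_fun_eq[OF dS])
  show "deriv (\<lambda>x. p * E (x - a) + q * E (x - b) + r * E (x - c))
        = (\<lambda>x. p * S (x - a) + q * S (x - b) + r * S (x - c))"
    by (rule deriv_fun_eq[OF dE])
qed

text \<open>As \<open>\<epsilon> \<rightarrow> 0\<close> the shifted mollifiers tend to point masses, so an estimate for mollified
  combinations with an error of order \<open>\<epsilon>\<close> passes to the point values. Three points suffice for first
  and second differences.\<close>

lemma mollified_combination_limit:
  fixes u :: "real \<Rightarrow> 'a::banach"
  assumes u: "continuous_on {0..T} u"
    and a: "0 < a" "a < T" and b: "0 < b" "b < T" and c: "0 < c" "c < T"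
    and bound: "\<And>\<epsilon> \<rho> S E. 0 < \<epsilon> \<Longrightarrow> \<epsilon> < \<epsilon>1 \<Longrightarrow> mollifier \<epsilon> \<rho> S E \<Longrightarrow>
       norm (integral {0..T} (\<lambda>s. (p * \<rho> (s - a) + q * \<rho> (s - b) + r * \<rho> (s - c)) *\<^sub>R u s)) 
       \<le> B + B' * \<epsilon>"
    and e1: "\<epsilon>1 > 0"
  shows "norm (p *\<^sub>R u a + q *\<^sub>R u b + r *\<^sub>R u c) \<le> B"
proof (rule field_le_epsilon)
  fix e :: real assume e: "e > 0"
  define w where "w = \<bar>p\<bar> + \<bar>q\<bar> + \<bar>r\<bar> + 1"
  have w: "w > 0" by (simp add: w_def)
  define \<delta> where "\<delta> = e / (2 * w)"
  have d: "\<delta> > 0" using e w by (simp add: \<delta>_def)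
  obtain ea where ea: "ea > 0" "\<And>\<epsilon> \<rho> S E. 0 < \<epsilon> \<Longrightarrow> \<epsilon> < ea \<Longrightarrow> mollifier \<epsilon> \<rho> S E \<Longrightarrow>
       norm (integral {0..T} (\<lambda>s. \<rho> (s - a) *\<^sub>R u s) - u a) \<le> \<delta>"
    using mollifier_approx[OF u a d] by blast
  obtain eb where eb: "eb > 0" "\<And>\<epsilon> \<rho> S E. 0 < \<epsilon> \<Longrightarrow> \<epsilon> < eb \<Longrightarrow> mollifier \<epsilon> \<rho> S E \<Longrightarrow>
       norm (integral {0..T} (\<lambda>s. \<rho> (s - b) *\<^sub>R u s) - u b) \<le> \<delta>"
    using mollifier_approx[OF u b d] by blast
  obtain ec where ec: "ec > 0" "\<And>\<epsilon> \<rho> S E. 0 < \<epsilon> \<Longrightarrow> \<epsilon> < ec \<Longrightarrow> mollifier \<epsilon> \<rho> S E \<Longrightarrow>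
       norm (integral {0..T} (\<lambda>s. \<rho> (s - c) *\<^sub>R u s) - u c) \<le> \<delta>"
    using mollifier_approx[OF u c d] by blast
  define e2 where "e2 = e / (2 * (\<bar>B'\<bar> + 1))"
  have e2: "e2 > 0" using e by (simp add: e2_def)
  define \<epsilon> where "\<epsilon> = min (min ea eb) (min (min ec \<epsilon>1) e2) / 2"
  have pos: "0 < \<epsilon>" unfolding \<epsilon>_def using ea(1) eb(1) ec(1) e1 e2 by auto
  have lt: "\<epsilon> < ea" "\<epsilon> < eb" "\<epsilon> < ec" "\<epsilon> < \<epsilon>1" "\<epsilon> < e2"
    using pos unfolding \<epsilon>_def by auto
  obtain \<rho> S E where m: "mollifier \<epsilon> \<rho> S E" using mollifier_exists[OF pos] by blast
  define J where "J = (\<lambda>x. integral {0..T} (\<lambda>s. \<rho> (s - x) *\<^sub>R u s))"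
  have J: "norm (J a - u a) \<le> \<delta>" "norm (J b - u b) \<le> \<delta>" "norm (J c - u c) \<le> \<delta>"
    using ea(2)[OF pos lt(1) m] eb(2)[OF pos lt(2) m] ec(2)[OF pos lt(3) m] by (auto simp: J_def)
  have hi: "((\<lambda>s. \<rho> (s - x) *\<^sub>R u s) has_integral J x) {0..T}" for x
    unfolding J_def by (rule integrable_integral[OF integrable_mollifier[OF m u]])
  have "((\<lambda>s. p *\<^sub>R (\<rho> (s - a) *\<^sub>R u s) + q *\<^sub>R (\<rho> (s - b) *\<^sub>R u s) + r *\<^sub>R (\<rho> (s - c) *\<^sub>R u s))
      has_integral p *\<^sub>R J a + q *\<^sub>R J b + r *\<^sub>R J c) {0..T}"
    by (intro has_integral_add has_integral_cmul hi)
  then have "integral {0..T} (\<lambda>s. (p * \<rho> (s - a) + q * \<rho> (s - b) + r * \<rho> (s - c)) *\<^sub>R u s)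
      = p *\<^sub>R J a + q *\<^sub>R J b + r *\<^sub>R J c"
    by (simp add: scaleR_add_left integral_unique)
  then have 1: "norm (p *\<^sub>R J a + q *\<^sub>R J b + r *\<^sub>R J c) \<le> B + B' * \<epsilon>"
    using bound[OF pos lt(4) m] by simp
  have "norm (p *\<^sub>R u a + q *\<^sub>R u b + r *\<^sub>R u c)
      = norm ((p *\<^sub>R J a + q *\<^sub>R J b + r *\<^sub>R J c)
        - (p *\<^sub>R (J a - u a) + q *\<^sub>R (J b - u b) + r *\<^sub>R (J c - u c)))"
    by (simp add: algebra_simps)
  also have "\<dots> \<le> norm (p *\<^sub>R J a + q *\<^sub>R J b + r *\<^sub>R J c)
        + (norm (p *\<^sub>R (J a - u a)) + norm (q *\<^sub>R (J b - u b)) + norm (r *\<^sub>R (J c - u c)))"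
    by (intro norm_triangle_le_diff add_left_mono norm_triangle_le norm_triangle_mono order_refl)
  also have "\<dots> \<le> (B + B' * \<epsilon>) + (\<bar>p\<bar> * \<delta> + \<bar>q\<bar> * \<delta> + \<bar>r\<bar> * \<delta>)"
    using 1 J by (intro add_mono) (auto intro: mult_left_mono)
  also have "\<bar>p\<bar> * \<delta> + \<bar>q\<bar> * \<delta> + \<bar>r\<bar> * \<delta> \<le> w * \<delta>"
    using d by (simp add: w_def algebra_simps)
  also have "w * \<delta> = e / 2" using w by (simp add: \<delta>_def)
  also have "B' * \<epsilon> \<le> (\<bar>B'\<bar> + 1) * \<epsilon>" using pos by (intro mult_right_mono) auto
  also have "(\<bar>B'\<bar> + 1) * \<epsilon> \<le> e / 2"
    using lt(5) by (simp add: e2_def field_simps)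
  finally show "norm (p *\<^sub>R u a + q *\<^sub>R u b + r *\<^sub>R u c) \<le> B + e" by simp
qed

text \<open>The supports of the test functions must stay away from the ends of the interval; continuity gives the
  estimates up to the ends.\<close>

lemma interior_bound_extends:
  fixes D :: "real \<Rightarrow> real"
  assumes "continuous_on {0..h} D" "\<And>s. 0 < s \<Longrightarrow> s < h \<Longrightarrow> D s \<le> 0" "h > 0"
  shows "D h \<le> 0"
  by (rule continuous_le_on_closure[of "{0<..<h}"]) (use assms in auto)

text \<open>The test function is \<open>S(\<cdot> - b) - S(\<cdot> - a)\<close>, minus a smoothed indicator of \<open>[a, b]\<close>. It has
  absolute value at most 1 and support of length \<open>b - a + 2 \<epsilon>\<close>, and its derivative tends to
  \<open>\<delta>\<^sub>b - \<delta>\<^sub>a\<close>.\<close>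

lemma weak_lipschitz:
  fixes u :: "real \<Rightarrow> 'a::banach"
  assumes u: "continuous_on {0..T} u" and weak: "weak_deriv T u u'"
    and bound: "AE t in lebesgue_on {0<..<T}. norm (u' t) \<le> M" and M: "M \<ge> 0"
    and ab: "0 \<le> a" "a \<le> b" "b \<le> T"
  shows "norm (u b - u a) \<le> M * (b - a)"
proof -
  have interior: "norm (u b - u a) \<le> M * (b - a)" if ab: "0 < a" "a \<le> b" "b < T" for a b
  proof -
    have "norm (1 *\<^sub>R u b + (-1) *\<^sub>R u a + 0 *\<^sub>R u a) \<le> M * (b - a)"
    proof (rule mollified_combination_limit[OF u])
      define \<epsilon>1 where "\<epsilon>1 = min a (T - b)"
      show "\<epsilon>1 > 0" using ab by (simp add: \<epsilon>1_def)
      fix \<epsilon> \<rho> S E assume e: "0 < \<epsilon>" "\<epsilon> < \<epsilon>1" and m: "mollifier \<epsilon> \<rho> S E"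
      note md = m[unfolded mollifier_def] and sb = mollifier_step_bounds[OF m e(1)]
      note sm = smooth_fun_mollifier_comb[OF m, where p=1 and q="-1" and r=0 and a=b and b=a and c=a]
      have "norm (integral {0..T} (\<lambda>s. deriv (\<lambda>x. 1 * S (x - b) + (-1) * S (x - a) + 0 * S (x - a)) s *\<^sub>R u s))
        \<le> M * 1 * ((b + \<epsilon>) - (a - \<epsilon>))"
      proof (rule weak_deriv_norm_bound[OF weak bound sm(2) _ _ _ _ _ M])
        show "0 < a - \<epsilon>" "a - \<epsilon> \<le> b + \<epsilon>" "b + \<epsilon> < T" using e ab by (auto simp: \<epsilon>1_def)
        fix t
        show "t \<le> a - \<epsilon> \<or> b + \<epsilon> \<le> t \<Longrightarrow> 1 * S (t - b) + - 1 * S (t - a) + 0 * S (t - a) = 0"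
          using md ab by auto
        show "\<bar>1 * S (t - b) + - 1 * S (t - a) + 0 * S (t - a)\<bar> \<le> 1"
          using sb(1)[of "t - a"] sb(2)[of "t - a"] sb(1)[of "t - b"] sb(2)[of "t - b"] by auto
      qed
      then show "norm (integral {0..T} (\<lambda>s. (1 * \<rho> (s - b) + (-1) * \<rho> (s - a) + 0 * \<rho> (s - a)) *\<^sub>R u s))
          \<le> M * (b - a) + 2 * M * \<epsilon>"
        unfolding sm(4) by (simp add: algebra_simps)
    qed (use ab in auto)
    then show ?thesis by simp
  qed
  show ?thesis
  proof (cases "a = b")
    case False
    define m where "m = (a + b) / 2"
    define h where "h = (b - a) / 2"
    have h: "h > 0" and mh: "m - h = a" "m + h = b" using ab False by (auto simp: h_def m_def field_simps)
    have "norm (u (m + h) - u (m - h)) - M * (2 * h) \<le> 0"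
    proof (rule interior_bound_extends[OF _ _ h])
      show "continuous_on {0..h} (\<lambda>h. norm (u (m + h) - u (m - h)) - M * (2 * h))"
        by (intro continuous_intros continuous_on_compose2[OF u]) (use mh ab in auto)
      show "norm (u (m + s) - u (m - s)) - M * (2 * s) \<le> 0" if "0 < s" "s < h" for s
        using interior[of "m - s" "m + s"] that mh ab by (auto simp: algebra_simps)
    qed
    moreover have "2 * h = b - a" by (simp add: h_def)
    ultimately show ?thesis unfolding mh by simp
  qed simp
qed

text \<open>The test function \<open>E(\<cdot> - (m + h)) - 2 E(\<cdot> - m) + E(\<cdot> - (m - h))\<close> is a smoothed hat of height at
  most \<open>h\<close> on an interval of length \<open>2 h + 2 \<epsilon>\<close>, and its second derivative tends to
  \<open>\<delta>\<^sub>m\<^sub>+\<^sub>h - 2 \<delta>\<^sub>m + \<delta>\<^sub>m\<^sub>-\<^sub>h\<close>.\<close>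

lemma weak_second_difference:
  fixes u :: "real \<Rightarrow> 'a::banach"
  assumes u: "continuous_on {0..T} u" and weak: "weak_deriv T u u'" "weak_deriv T u' u''"
    and bound: "AE t in lebesgue_on {0<..<T}. norm (u'' t) \<le> M" and M: "M \<ge> 0"
    and mh: "0 \<le> h" "0 \<le> m - h" "m + h \<le> T"
  shows "norm (u (m + h) - 2 *\<^sub>R u m + u (m - h)) \<le> 2 * M * h\<^sup>2"
proof -
  have interior: "norm (u (m + h) - 2 *\<^sub>R u m + u (m - h)) \<le> 2 * M * h\<^sup>2"
    if mh: "0 < h" "0 < m - h" "m + h < T" for h
  proof -
    have "norm (1 *\<^sub>R u (m + h) + (-2) *\<^sub>R u m + 1 *\<^sub>R u (m - h)) \<le> 2 * M * h\<^sup>2"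
    proof (rule mollified_combination_limit[OF u])
      define \<epsilon>1 where "\<epsilon>1 = min (m - h) (T - (m + h))"
      show "\<epsilon>1 > 0" using mh by (simp add: \<epsilon>1_def)
      fix \<epsilon> \<rho> S E assume e: "0 < \<epsilon>" "\<epsilon> < \<epsilon>1" and mo: "mollifier \<epsilon> \<rho> S E"
      note md = mo[unfolded mollifier_def] and sb = mollifier_step_bounds[OF mo e(1)]
      obtain c where c: "\<And>x. x \<ge> \<epsilon> \<Longrightarrow> E x = x + c" using md by auto
      note sm = smooth_fun_mollifier_comb[OF mo, where p=1 and q="-2" and r=1 and a="m + h" and b=m and c="m - h"]
      define \<psi> where "\<psi> = (\<lambda>x. 1 * E (x - (m + h)) + (-2) * E (x - m) + 1 * E (x - (m - h)))"
      define S' where "S' = (\<lambda>x. 1 * S (x - (m + h)) + (-2) * S (x - m) + 1 * S (x - (m - h)))"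
      define \<rho>' where "\<rho>' = (\<lambda>x. 1 * \<rho> (x - (m + h)) + (-2) * \<rho> (x - m) + 1 * \<rho> (x - (m - h)))"
      note sm = sm[folded \<psi>_def S'_def \<rho>'_def]
      have cd: "0 < m - h - \<epsilon>" "m - h - \<epsilon> \<le> m + h + \<epsilon>" "m + h + \<epsilon> < T"
        using e mh by (auto simp: \<epsilon>1_def)
      have "S' t = 0" if "t \<le> m - h - \<epsilon> \<or> m + h + \<epsilon> \<le> t" for t
        using that md mh by (auto simp: S'_def)
      then have "test_function T S'" by (rule test_functionI[OF sm(2) cd(1,3)])
      then have "integral {0..T} (\<lambda>t. deriv S' t *\<^sub>R u t) = - integral {0..T} (\<lambda>t. S' t *\<^sub>R u' t)"
        using weak(1) by (simp add: weak_deriv_def)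
      then have "integral {0..T} (\<lambda>t. \<rho>' t *\<^sub>R u t) = - integral {0..T} (\<lambda>t. deriv \<psi> t *\<^sub>R u' t)"
        unfolding sm(4,5) .
      moreover have "norm (integral {0..T} (\<lambda>t. deriv \<psi> t *\<^sub>R u' t)) \<le> M * h * ((m + h + \<epsilon>) - (m - h - \<epsilon>))"
      proof (rule weak_deriv_norm_bound[OF weak(2) bound sm(3) cd _ _ M])
        fix t
        show "t \<le> m - h - \<epsilon> \<or> m + h + \<epsilon> \<le> t \<Longrightarrow> \<psi> t = 0"
          using md c[of "t - (m + h)"] c[of "t - m"] c[of "t - (m - h)"] mh by (auto simp: \<psi>_def)
        show "\<bar>\<psi> t\<bar> \<le> h"
          using sb(3,4)[of "t - (m + h)" "t - m"] sb(3,4)[of "t - m" "t - (m - h)"] mh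
          by (auto simp: \<psi>_def)
      qed
      ultimately show "norm (integral {0..T} (\<lambda>s. (1 * \<rho> (s - (m + h)) + (-2) * \<rho> (s - m)
            + 1 * \<rho> (s - (m - h))) *\<^sub>R u s)) \<le> 2 * M * h\<^sup>2 + 2 * M * h * \<epsilon>"
        by (simp add: \<rho>'_def algebra_simps power2_eq_square)
    qed (use mh in auto)
    then show ?thesis by simp
  qed
  show ?thesis
  proof (cases "h = 0")
    case False
    then have h: "h > 0" using mh by simp
    have "norm (u (m + h) - 2 *\<^sub>R u m + u (m - h)) - 2 * M * h\<^sup>2 \<le> 0"
    proof (rule interior_bound_extends[OF _ _ h])
      show "continuous_on {0..h} (\<lambda>h. norm (u (m + h) - 2 *\<^sub>R u m + u (m - h)) - 2 * M * h\<^sup>2)"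
        by (intro continuous_intros continuous_on_compose2[OF u]) (use mh in auto)
      show "norm (u (m + s) - 2 *\<^sub>R u m + u (m - s)) - 2 * M * s\<^sup>2 \<le> 0" if "0 < s" "s < h" for s
        using interior[of s] that mh by auto
    qed
    then show ?thesis by simp
  qed (simp add: scaleR_2)
qed

lemma W2inf_differences:
  fixes u :: "real \<Rightarrow> 'a::banach"
  assumes u: "continuous_on {0..T} u" and W: "W2inf T u"
  obtains M where "M \<ge> 0"
    "\<And>a b. 0 \<le> a \<Longrightarrow> a \<le> b \<Longrightarrow> b \<le> T \<Longrightarrow> norm (u b - u a) \<le> M * (b - a)"
    "\<And>m h. 0 \<le> h \<Longrightarrow> 0 \<le> m - h \<Longrightarrow> m + h \<le> T \<Longrightarrow> norm (u (m + h) - 2 *\<^sub>R u m + u (m - h)) \<le> M * h\<^sup>2"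
proof -
  obtain u' u'' where w: "Linf T u'" "Linf T u''" "weak_deriv T u u'" "weak_deriv T u' u''"
    using W by (auto simp: W2inf_def)
  obtain M1 M2 where M1: "AE t in lebesgue_on {0<..<T}. norm (u' t) \<le> M1"
    and M2: "AE t in lebesgue_on {0<..<T}. norm (u'' t) \<le> M2"
    using w(1,2) by (auto simp: Linf_def)
  define M where "M = \<bar>M1\<bar> + \<bar>M2\<bar>"
  have M: "M \<ge> 0" by (simp add: M_def)
  have B1: "AE t in lebesgue_on {0<..<T}. norm (u' t) \<le> M"
    by (rule AE_mp[OF M1]) (auto simp: M_def)
  have B2: "AE t in lebesgue_on {0<..<T}. norm (u'' t) \<le> M"
    by (rule AE_mp[OF M2]) (auto simp: M_def)
  show ?thesis
  proof (rule that[of "2 * M"])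
    show "norm (u b - u a) \<le> 2 * M * (b - a)" if "0 \<le> a" "a \<le> b" "b \<le> T" for a b
    proof -
      have "M * (b - a) \<le> 2 * M * (b - a)" using M that by (intro mult_right_mono) auto
      then show ?thesis using weak_lipschitz[OF u w(3) B1 M that] by linarith
    qed
  qed (use M weak_second_difference[OF u w(3,4) B2 M] in auto)
qed

section \<open>Second-order accuracy of the history quadrature\<close>

lemma C2_kernel_differences:
  fixes q :: "real \<times> real \<Rightarrow> 'a::real_normed_vector"
  assumes q: "C2_on ({0..} \<times> {0..}) q" and T: "T \<ge> 0"
  obtains Q where "Q \<ge> 0"
    "\<And>t s. t \<in> {0..T} \<Longrightarrow> s \<in> {0..T} \<Longrightarrow> norm (q (t, s)) \<le> Q"
    "\<And>t a b. t \<in> {0..T} \<Longrightarrow> 0 \<le> a \<Longrightarrow> a \<le> b \<Longrightarrow> b \<le> T \<Longrightarrow> norm (q (t, b) - q (t, a)) \<le> Q * (b - a)"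
    "\<And>t m h. t \<in> {0..T} \<Longrightarrow> 0 \<le> h \<Longrightarrow> 0 \<le> m - h \<Longrightarrow> m + h \<le> T \<Longrightarrow>
       norm (q (t, m + h) - 2 *\<^sub>R q (t, m) + q (t, m - h)) \<le> Q * h\<^sup>2"
proof -
  define K where "K = {0..T} \<times> {0..T}"
  have KS: "K \<subseteq> {0..} \<times> {0..}" by (auto simp: K_def)
  have K: "compact K" "convex K" unfolding K_def by (intro compact_Times convex_Times compact_Icc convex_real_interval)+
  obtain g' :: "real \<times> real \<Rightarrow> (real \<times> real) \<Rightarrow>\<^sub>L 'a"
    and g'' :: "real \<times> real \<Rightarrow> (real \<times> real) \<Rightarrow>\<^sub>L ((real \<times> real) \<Rightarrow>\<^sub>L 'a)"
    where d: "\<And>p. p \<in> {0..} \<times> {0..} \<Longrightarrow> (q has_derivative g' p) (at p within {0..} \<times> {0..})"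
      "\<And>p. p \<in> {0..} \<times> {0..} \<Longrightarrow> (g' has_derivative g'' p) (at p within {0..} \<times> {0..})"
      and c: "continuous_on ({0..} \<times> {0..}) g''"
    using q unfolding C2_on_def by blast
  have dq: "(q has_derivative g' p) (at p within K)" if "p \<in> K" for p
    using has_derivative_subset[OF d(1) KS] that KS by blast
  have dg: "(g' has_derivative g'' p) (at p within K)" if "p \<in> K" for p
    using has_derivative_subset[OF d(2) KS] that KS by blast
  have bounded: "\<exists>B\<ge>0. \<forall>p\<in>K. norm (f p) \<le> B" if "continuous_on K f" 
    for f :: "real \<times> real \<Rightarrow> 'b::real_normed_vector"
    using compact_imp_bounded[OF compact_continuous_image[OF that K(1)]]
    by (auto simp: bounded_pos intro: less_imp_le)
  have "continuous_on K q" "continuous_on K g'"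
    using dq dg by (auto intro!: has_derivative_continuous_on)
  then obtain B0 B1 where B0: "B0 \<ge> 0" "\<And>p. p \<in> K \<Longrightarrow> norm (q p) \<le> B0"
    and B1: "B1 \<ge> 0" "\<And>p. p \<in> K \<Longrightarrow> norm (g' p) \<le> B1"
    using bounded[of q] bounded[of g'] by blast
  obtain B2 where B2: "B2 \<ge> 0" "\<And>p. p \<in> K \<Longrightarrow> norm (g'' p) \<le> B2"
    using bounded[OF continuous_on_subset[OF c KS]] by blast
  have Lq: "norm (q x - q y) \<le> B1 * norm (x - y)" if "x \<in> K" "y \<in> K" for x y
    by (rule differentiable_bound[OF K(2) dq _ that]) (use B1 in \<open>auto simp: norm_blinfun.rep_eq[symmetric]\<close>)
  have Lg: "norm (g' x - g' y) \<le> B2 * norm (x - y)" if "x \<in> K" "y \<in> K" for x y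
    by (rule differentiable_bound[OF K(2) dg _ that]) (use B2 in \<open>auto simp: norm_blinfun.rep_eq[symmetric]\<close>)
  have second: "norm (q (t, m + h) - 2 *\<^sub>R q (t, m) + q (t, m - h)) \<le> 2 * B2 * h\<^sup>2"
    if t: "t \<in> {0..T}" and h: "0 \<le> h" "0 \<le> m - h" "m + h \<le> T" for t m h
  proof -
    \<comment> \<open>The second difference is \<open>F h - F 0\<close>, and \<open>F'\<close> is a difference of values of \<open>g'\<close> at points
      with distance \<open>2 r\<close>.\<close>
    define F where "F = (\<lambda>r. q (t, m + r) + q (t, m - r))"
    define F' where "F' = (\<lambda>r x. g' (t, m + r) (0, x) + g' (t, m - r) (0, - x))"
    have inK: "(t, m + r) \<in> K" "(t, m - r) \<in> K" if "r \<in> {0..h}" for r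
      using that t h by (auto simp: K_def)
    have dF: "(F has_derivative F' r) (at r within {0..h})" if r: "r \<in> {0..h}" for r
    proof -
      have "((\<lambda>r. q (t, m + r)) has_derivative (\<lambda>x. g' (t, m + r) (0, x))) (at r within {0..h})"
        by (rule has_derivative_in_compose2[of K q "\<lambda>p. blinfun_apply (g' p)" "\<lambda>r. (t, m + r)"])
          (use dq inK r in \<open>auto intro!: derivative_eq_intros\<close>)
      moreover have "((\<lambda>r. q (t, m - r)) has_derivative (\<lambda>x. g' (t, m - r) (0, - x))) (at r within {0..h})"
        by (rule has_derivative_in_compose2[of K q "\<lambda>p. blinfun_apply (g' p)" "\<lambda>r. (t, m - r)"])
          (use dq inK r in \<open>auto intro!: derivative_eq_intros\<close>)
      ultimately show ?thesis unfolding F_def F'_def by (rule has_derivative_add)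
    qed
    have "norm (F h - F 0) \<le> (2 * B2 * h) * norm (h - 0)"
    proof (rule differentiable_bound[OF _ dF])
      fix r assume r: "r \<in> {0..h}"
      show "onorm (F' r) \<le> 2 * B2 * h"
      proof (rule onorm_bound)
        show "0 \<le> 2 * B2 * h" using B2 h by simp
        fix x :: real
        have eq: "F' r x = (g' (t, m + r) - g' (t, m - r)) (0, x)"
          using blinfun.minus_right[of "g' (t, m - r)" "(0, x)"]
          by (simp add: F'_def blinfun.diff_left)
        have "norm (F' r x) \<le> norm (g' (t, m + r) - g' (t, m - r)) * norm x"
          unfolding eq using norm_blinfun[of "g' (t, m + r) - g' (t, m - r)" "(0, x)"] by (simp add: norm_Pair)
        also have "norm (g' (t, m + r) - g' (t, m - r)) \<le> B2 * norm ((t, m + r) - (t, m - r))"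
          by (rule Lg[OF inK[OF r]])
        also have "(t, m + r) - (t, m - r) = (0, 2 * r)" by simp
        also have "norm (0 :: real, 2 * r) = 2 * r" using r by simp
        also have "B2 * (2 * r) \<le> 2 * B2 * h" using r B2 by (simp add: mult_left_mono)
        finally show "norm (F' r x) \<le> 2 * B2 * h * norm x" by (simp add: mult_right_mono)
      qed
    qed (use h in auto)
    moreover have "F h - F 0 = q (t, m + h) - 2 *\<^sub>R q (t, m) + q (t, m - h)"
      by (simp add: F_def scaleR_2)
    ultimately show ?thesis using h by (simp add: power2_eq_square)
  qed
  show ?thesis
  proof (rule that[of "B0 + B1 + 2 * B2"])
    show "0 \<le> B0 + B1 + 2 * B2" using B0 B1 B2 by simp
    show "norm (q (t, s)) \<le> B0 + B1 + 2 * B2" if "t \<in> {0..T}" "s \<in> {0..T}" for t s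
      using B0(2)[of "(t, s)"] that B1 B2 by (simp add: K_def)
    show "norm (q (t, b) - q (t, a)) \<le> (B0 + B1 + 2 * B2) * (b - a)"
      if "t \<in> {0..T}" "0 \<le> a" "a \<le> b" "b \<le> T" for t a b
    proof -
      have "norm (q (t, b) - q (t, a)) \<le> B1 * (b - a)"
        using Lq[of "(t, b)" "(t, a)"] that by (simp add: K_def norm_Pair)
      also have "\<dots> \<le> (B0 + B1 + 2 * B2) * (b - a)"
        using B0 B2 that by (intro mult_right_mono) auto
      finally show ?thesis .
    qed
    show "norm (q (t, m + h) - 2 *\<^sub>R q (t, m) + q (t, m - h)) \<le> (B0 + B1 + 2 * B2) * h\<^sup>2"
      if "t \<in> {0..T}" "0 \<le> h" "0 \<le> m - h" "m + h \<le> T" for t m h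
    proof -
      have "2 * B2 * h\<^sup>2 \<le> (B0 + B1 + 2 * B2) * h\<^sup>2"
        using B0 B1 by (intro mult_right_mono) auto
      then show ?thesis using second[OF that] by linarith
    qed
  qed
qed

lemma integral_reflect_interval:
  fixes G :: "real \<Rightarrow> 'a::banach"
  assumes "continuous_on {a..b} G" "a \<le> b"
  shows "((\<lambda>s. G (a + b - s)) has_integral integral {a..b} G) {a..b}"
proof -
  have "(G has_integral integral {a..b} G) (cbox a b)"
    using integrable_continuous_real[OF assms(1)] by (simp add: integrable_integral)
  from has_integral_affinity[OF this, of "-1" "a + b"]
  have "((\<lambda>s. G (a + b - s)) has_integral integral {a..b} G) ((\<lambda>x. a + b - x) ` {a..b})"
    by (simp add: algebra_simps)
  also have "(\<lambda>x. a + b - x) ` {a..b} = {a..b}"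
    using assms(2) by (simp add: image_minus_const_atLeastAtMost')
  finally show ?thesis .
qed

text \<open>Averaging the integral with its reflection replaces \<open>G(s)\<close> by \<open>(G(s) + G(a + b - s)) / 2\<close>. This and
  \<open>(G(a) + G(b)) / 2\<close> both differ from the value at the midpoint by half a second difference.\<close>

lemma trapezoid_error:
  fixes G :: "real \<Rightarrow> 'a::banach"
  assumes G: "continuous_on {a..b} G" and ab: "a \<le> b"
    and second: "\<And>h. 0 \<le> h \<Longrightarrow> h \<le> (b - a) / 2 \<Longrightarrow>
      norm (G ((a + b) / 2 + h) - 2 *\<^sub>R G ((a + b) / 2) + G ((a + b) / 2 - h)) \<le> C * h\<^sup>2"
    and C: "C \<ge> 0"
  shows "norm (integral {a..b} G - ((b - a) / 2) *\<^sub>R (G a + G b)) \<le> C * (b - a) ^ 3"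
proof -
  define m where "m = (a + b) / 2"
  define k where "k = b - a"
  have k: "k \<ge> 0" using ab by (simp add: k_def)
  have ends: "m + k / 2 = b" "m - k / 2 = a" by (auto simp: m_def k_def field_simps)
  have sec: "norm (G (m + h) - 2 *\<^sub>R G m + G (m - h)) \<le> C * k\<^sup>2 / 4" if "\<bar>h\<bar> \<le> k / 2" for h
  proof -
    have "norm (G (m + \<bar>h\<bar>) - 2 *\<^sub>R G m + G (m - \<bar>h\<bar>)) \<le> C * \<bar>h\<bar>\<^sup>2"
      using second[of "\<bar>h\<bar>"] that by (simp add: m_def k_def)
    also have "\<dots> \<le> C * (k / 2)\<^sup>2"
      using that C by (intro mult_left_mono power_mono) auto
    finally show ?thesis
      by (cases "h \<ge> 0") (auto simp: power_divide algebra_simps)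
  qed
  have i1: "(G has_integral integral {a..b} G) {a..b}"
    using integrable_continuous_real[OF G] by (simp add: integrable_integral)
  have i3: "((\<lambda>s. G a + G b) has_integral k *\<^sub>R (G a + G b)) {a..b}"
    using has_integral_const_real[of "G a + G b" a b] ab by (simp add: k_def)
  have i: "((\<lambda>s. (G s + G (a + b - s)) - (G a + G b)) has_integral
      (integral {a..b} G + integral {a..b} G) - k *\<^sub>R (G a + G b)) {a..b}"
    by (intro has_integral_diff has_integral_add i1 i3 integral_reflect_interval G ab)
  have "norm ((integral {a..b} G + integral {a..b} G) - k *\<^sub>R (G a + G b)) \<le> (C * k\<^sup>2 / 2) * measure lborel (cbox a b)"
  proof (rule has_integral_bound[where f="\<lambda>s. (G s + G (a + b - s)) - (G a + G b)"])
    show "0 \<le> C * k\<^sup>2 / 2" using C by simp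
    show "((\<lambda>s. (G s + G (a + b - s)) - (G a + G b)) has_integral
      (integral {a..b} G + integral {a..b} G) - k *\<^sub>R (G a + G b)) (cbox a b)" using i by simp
    fix s assume "s \<in> cbox a b"
    then have s: "\<bar>s - m\<bar> \<le> k / 2" by (auto simp: m_def k_def abs_le_iff field_simps)
    have e: "m + (s - m) = s" "m - (s - m) = a + b - s" by (auto simp: m_def field_simps)
    have "(G s + G (a + b - s)) - (G a + G b)
        = (G s - 2 *\<^sub>R G m + G (a + b - s)) - (G b - 2 *\<^sub>R G m + G a)"
      by simp
    also have "norm \<dots> \<le> norm (G s - 2 *\<^sub>R G m + G (a + b - s)) + norm (G b - 2 *\<^sub>R G m + G a)"
      by (rule norm_triangle_ineq4)
    also have "\<dots> \<le> C * k\<^sup>2 / 4 + C * k\<^sup>2 / 4"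
      using sec[OF s] sec[of "k / 2"] k unfolding e ends by (intro add_mono) auto
    finally show "norm ((G s + G (a + b - s)) - (G a + G b)) \<le> C * k\<^sup>2 / 2" by simp
  qed
  also have "(C * k\<^sup>2 / 2) * measure lborel (cbox a b) = C * k ^ 3 / 2"
    using ab by (simp add: k_def power2_eq_square power3_eq_cube)
  also have "(integral {a..b} G + integral {a..b} G) - k *\<^sub>R (G a + G b)
      = 2 *\<^sub>R (integral {a..b} G - (k / 2) *\<^sub>R (G a + G b))"
    by (simp add: scaleR_diff_right scaleR_2[symmetric])
  finally have "norm (integral {a..b} G - (k / 2) *\<^sub>R (G a + G b)) \<le> C * k ^ 3 / 4" by simp
  also have "\<dots> \<le> C * k ^ 3" using C k by simp
  finally show ?thesis by (simp add: k_def)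
qed

lemma trapezoid_sum_rearrange:
  fixes G :: "nat \<Rightarrow> 'a::real_vector"
  shows "(\<Sum>i<Suc n. (k / 2) *\<^sub>R (G i + G (Suc i)))
    = (k / 2) *\<^sub>R G 0 + k *\<^sub>R (\<Sum>i=1..n. G i) + (k / 2) *\<^sub>R G (Suc n)"
proof (induction n)
  case (Suc n)
  have "k *\<^sub>R G (Suc n) = (k / 2) *\<^sub>R G (Suc n) + (k / 2) *\<^sub>R G (Suc n)"
    by (simp flip: scaleR_add_left)
  then show ?case unfolding sum.lessThan_Suc[of _ "Suc n"] Suc
    by (simp add: scaleR_add_right algebra_simps)
qed (simp add: scaleR_add_right)

lemma composite_trapezoid_error:
  fixes G :: "real \<Rightarrow> 'a::banach"
  assumes G: "continuous_on {0..real n * k} G" and k: "k \<ge> 0" and C: "C \<ge> 0"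
    and second: "\<And>m h. 0 \<le> h \<Longrightarrow> 0 \<le> m - h \<Longrightarrow> m + h \<le> real n * k \<Longrightarrow>
      norm (G (m + h) - 2 *\<^sub>R G m + G (m - h)) \<le> C * h\<^sup>2"
  shows "norm (integral {0..real n * k} G
      - (\<Sum>i<n. (k / 2) *\<^sub>R (G (real i * k) + G (real (Suc i) * k)))) \<le> real n * (C * k ^ 3)"
  using G second
proof (induction n)
  case (Suc n)
  let ?a = "real n * k" and ?b = "real (Suc n) * k"
  have ab: "0 \<le> ?a" "?a \<le> ?b" and bk: "?b - ?a = k" using k by (auto simp: algebra_simps)
  have IH: "norm (integral {0..?a} G - (\<Sum>i<n. (k / 2) *\<^sub>R (G (real i * k) + G (real (Suc i) * k))))
      \<le> real n * (C * k ^ 3)"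
    using ab by (intro Suc.IH continuous_on_subset[OF Suc.prems(1)] Suc.prems(2)) auto
  have split: "integral {0..?b} G = integral {0..?a} G + integral {?a..?b} G"
    using Henstock_Kurzweil_Integration.integral_combine[OF ab integrable_continuous_real[OF Suc.prems(1)]] by simp
  have last: "norm (integral {?a..?b} G - (k / 2) *\<^sub>R (G ?a + G ?b)) \<le> C * k ^ 3"
  proof -
    have "norm (integral {?a..?b} G - ((?b - ?a) / 2) *\<^sub>R (G ?a + G ?b)) \<le> C * (?b - ?a) ^ 3"
    proof (rule trapezoid_error[OF continuous_on_subset[OF Suc.prems(1)] ab(2) Suc.prems(2) C])
      show "{?a..?b} \<subseteq> {0..?b}" using ab by auto
      fix h assume h: "h \<le> (?b - ?a) / 2"
      show "0 \<le> (?a + ?b) / 2 - h" "(?a + ?b) / 2 + h \<le> ?b" using ab h by argo+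
    qed
    then show ?thesis unfolding bk .
  qed
  have "norm (integral {0..?b} G - (\<Sum>i<Suc n. (k / 2) *\<^sub>R (G (real i * k) + G (real (Suc i) * k))))
      = norm ((integral {0..?a} G - (\<Sum>i<n. (k / 2) *\<^sub>R (G (real i * k) + G (real (Suc i) * k))))
        + (integral {?a..?b} G - (k / 2) *\<^sub>R (G ?a + G ?b)))"
    unfolding split sum.lessThan_Suc by (simp add: algebra_simps)
  also have "\<dots> \<le> real n * (C * k ^ 3) + C * k ^ 3"
    by (rule norm_triangle_mono[OF IH last])
  finally show ?case by (simp add: algebra_simps)
qed simp

text \<open>The integrand \<open>q(t, \<cdot>) u\<close> inherits Lipschitz and second difference bounds from its factors by the
  discrete product rule, so the trapezoidal rule has an error \<open>O(k\<^sup>2)\<close>. Using \<open>t\<^sub>n\<^sub>-\<^sub>1\<close> in place of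
  \<open>t\<^sub>n\<close> in the last term costs \<open>k/2\<close> times a Lipschitz increment, again \<open>O(k\<^sup>2)\<close>.\<close>

lemma history_discr_consistent:
  fixes u :: "real \<Rightarrow> 'x::banach" and R :: "'x \<Rightarrow>\<^sub>L 'y::real_normed_vector"
    and q :: "real \<times> real \<Rightarrow> ('x \<Rightarrow>\<^sub>L 'x)"
  assumes T: "T > 0" and u: "continuous_on {0..} u" and W: "W2inf T u"
    and q: "continuous_on ({0..} \<times> {0..}) q" "C2_on ({0..} \<times> {0..}) q"
  obtains C where "C \<ge> 0"
    "\<And>k n. k > 0 \<Longrightarrow> real n * k \<le> T \<Longrightarrow>
      norm (history_op R q aS u (real n * k) - history_discr R q aS k n (\<lambda>i. u (real i * k))) \<le> C * k\<^sup>2"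
proof -
  have uT: "continuous_on {0..T} u" using u by (rule continuous_on_subset) auto
  obtain M where M: "M \<ge> 0"
    "\<And>a b. 0 \<le> a \<Longrightarrow> a \<le> b \<Longrightarrow> b \<le> T \<Longrightarrow> norm (u b - u a) \<le> M * (b - a)"
    "\<And>m h. 0 \<le> h \<Longrightarrow> 0 \<le> m - h \<Longrightarrow> m + h \<le> T \<Longrightarrow> norm (u (m + h) - 2 *\<^sub>R u m + u (m - h)) \<le> M * h\<^sup>2"
    using W2inf_differences[OF uT W] by blast
  obtain Q where Q: "Q \<ge> 0"
    "\<And>t s. t \<in> {0..T} \<Longrightarrow> s \<in> {0..T} \<Longrightarrow> norm (q (t, s)) \<le> Q"
    "\<And>t a b. t \<in> {0..T} \<Longrightarrow> 0 \<le> a \<Longrightarrow> a \<le> b \<Longrightarrow> b \<le> T \<Longrightarrow> norm (q (t, b) - q (t, a)) \<le> Q * (b - a)"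
    "\<And>t m h. t \<in> {0..T} \<Longrightarrow> 0 \<le> h \<Longrightarrow> 0 \<le> m - h \<Longrightarrow> m + h \<le> T \<Longrightarrow>
       norm (q (t, m + h) - 2 *\<^sub>R q (t, m) + q (t, m - h)) \<le> Q * h\<^sup>2"
    using C2_kernel_differences[OF q(2) less_imp_le[OF T]] by blast
  obtain U where U: "U \<ge> 0" "\<And>s. s \<in> {0..T} \<Longrightarrow> norm (u s) \<le> U"
    using compact_imp_bounded[OF compact_continuous_image[OF uT compact_Icc]]
    by (auto simp: bounded_pos) (metis less_imp_le atLeastAtMost_iff)
  define C1 where "C1 = Q * M + Q * U + 2 * (Q * M)"
  define C2 where "C2 = Q * U + Q * M"
  have C1: "C1 \<ge> 0" and C2: "C2 \<ge> 0" using M(1) Q(1) U(1) by (auto simp: C1_def C2_def)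
  define C where "C = norm R * (T * C1 + C2)"
  show ?thesis
  proof (rule that[of C])
    show "C \<ge> 0" using C1 C2 T by (simp add: C_def)
    fix k :: real and n :: nat
    assume k: "k > 0" and nk: "real n * k \<le> T"
    define t where "t = real n * k"
    have t: "t \<in> {0..T}" using k nk by (simp add: t_def)
    define G where "G = (\<lambda>s. q (t, s) (u s))"
    have lip: "norm (G b - G a) \<le> C2 * (b - a)" if ab: "0 \<le> a" "a \<le> b" "b \<le> T" for a b
    proof -
      have "G b - G a = (q (t, b) - q (t, a)) (u b) + q (t, a) (u b - u a)"
        by (simp add: G_def blinfun.diff_left blinfun.diff_right)
      also have "norm \<dots> \<le> norm (q (t, b) - q (t, a)) * norm (u b) + norm (q (t, a)) * norm (u b - u a)"
        by (intro norm_triangle_mono norm_blinfun)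
      also have "\<dots> \<le> (Q * (b - a)) * U + Q * (M * (b - a))"
        using ab t by (intro add_mono mult_mono Q M U) (auto intro!: mult_nonneg_nonneg Q M)
      finally show ?thesis by (simp add: C2_def algebra_simps)
    qed
    have sec: "norm (G (m + h) - 2 *\<^sub>R G m + G (m - h)) \<le> C1 * h\<^sup>2"
      if h: "0 \<le> h" "0 \<le> m - h" "m + h \<le> T" for m h
    proof -
      let ?a = "q (t, m)" and ?b = "q (t, m + h)" and ?c = "q (t, m - h)"
      have eq: "G (m + h) - 2 *\<^sub>R G m + G (m - h)
          = ?a (u (m + h) - 2 *\<^sub>R u m + u (m - h)) + (?b - 2 *\<^sub>R ?a + ?c) (u m)
            + ((?b - ?a) (u (m + h) - u m) + (?a - ?c) (u m - u (m - h)))"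
        by (simp add: G_def blinfun.diff_left blinfun.diff_right blinfun.add_left blinfun.add_right
            blinfun.scaleR_left blinfun.scaleR_right scaleR_2)
      have "norm (G (m + h) - 2 *\<^sub>R G m + G (m - h)) \<le>
          norm ?a * norm (u (m + h) - 2 *\<^sub>R u m + u (m - h)) + norm (?b - 2 *\<^sub>R ?a + ?c) * norm (u m)
            + (norm (?b - ?a) * norm (u (m + h) - u m) + norm (?a - ?c) * norm (u m - u (m - h)))"
        unfolding eq by (intro norm_triangle_mono norm_blinfun)
      also have "\<dots> \<le> Q * (M * h\<^sup>2) + (Q * h\<^sup>2) * U + ((Q * h) * (M * h) + (Q * h) * (M * h))"
        using h t Q(2)[of t m] Q(3)[of t m "m + h"] Q(3)[of t "m - h" m] Q(4)[of t h m]
          M(2)[of m "m + h"] M(2)[of "m - h" m] M(3)[of h m] U(2)[of m] Q(1) M(1)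
        by (intro add_mono mult_mono) auto
      finally show ?thesis by (simp add: C1_def algebra_simps power2_eq_square)
    qed
    have contG: "continuous_on {0..t} G"
      unfolding G_def
      by (intro bounded_bilinear.continuous_on[OF bounded_bilinear_blinfun_apply]
          continuous_on_compose2[OF q(1)] continuous_on_subset[OF u] continuous_intros) (use t in auto)
    show "norm (history_op R q aS u (real n * k) - history_discr R q aS k n (\<lambda>i. u (real i * k))) \<le> C * k\<^sup>2"
    proof (cases n)
      case 0
      have "0 \<le> C * k\<^sup>2" using C1 C2 T by (simp add: C_def)
      then show ?thesis using 0 by (simp add: history_op_def history_discr_def)
    next
      case (Suc p)
      define g where "g = (\<lambda>i::nat. G (real i * k))"
      define D where "D = (k / 2) *\<^sub>R g 0 + k *\<^sub>R (\<Sum>i=1..p. g i) + (k / 2) *\<^sub>R g p"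
      have "norm (integral {0..t} G - (\<Sum>i<n. (k / 2) *\<^sub>R (g i + g (Suc i)))) \<le> real n * (C1 * k ^ 3)"
        unfolding g_def t_def
        by (rule composite_trapezoid_error)
          (use contG k C1 sec t in \<open>auto simp: t_def\<close>)
      also have "\<dots> = t * C1 * k\<^sup>2" by (simp add: t_def power2_eq_square power3_eq_cube)
      also have "\<dots> \<le> T * C1 * k\<^sup>2" using t C1 by (intro mult_right_mono) auto
      finally have 1: "norm (integral {0..t} G - (\<Sum>i<n. (k / 2) *\<^sub>R (g i + g (Suc i)))) \<le> T * C1 * k\<^sup>2" .
      have eq: "(\<Sum>i<n. (k / 2) *\<^sub>R (g i + g (Suc i))) - D = (k / 2) *\<^sub>R (g n - g p)"
        unfolding Suc trapezoid_sum_rearrange D_def by (simp add: algebra_simps)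
      have "norm (g n - g p) \<le> C2 * k"
        using lip[of "real p * k" "real n * k"] k t by (simp add: g_def Suc t_def algebra_simps)
      then have "k / 2 * norm (g n - g p) \<le> k / 2 * (C2 * k)"
        using k by (intro mult_left_mono) auto
      then have "norm ((\<Sum>i<n. (k / 2) *\<^sub>R (g i + g (Suc i))) - D) \<le> C2 * k\<^sup>2 / 2"
        unfolding eq using k by (simp add: power2_eq_square mult_ac)
      also have "\<dots> \<le> C2 * k\<^sup>2" using C2 by simp
      finally have 2: "norm ((\<Sum>i<n. (k / 2) *\<^sub>R (g i + g (Suc i))) - D) \<le> C2 * k\<^sup>2" .
      have "norm (integral {0..t} G - D) \<le> T * C1 * k\<^sup>2 + C2 * k\<^sup>2"
        using norm_triangle_mono[OF 1 2] by simp
      moreover have "history_op R q aS u (real n * k) - history_discr R q aS k n (\<lambda>i. u (real i * k))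
          = R (integral {0..t} G - D)"
        unfolding history_op_def history_discr_def Let_def
        by (simp add: Suc D_def g_def G_def t_def flip: blinfun.diff_right)
      moreover have "norm (R (integral {0..t} G - D)) \<le> norm R * norm (integral {0..t} G - D)"
        by (rule norm_blinfun)
      moreover have "norm R * norm (integral {0..t} G - D) \<le> norm R * (T * C1 * k\<^sup>2 + C2 * k\<^sup>2)"
        using calculation(1) by (rule mult_left_mono) simp
      ultimately show ?thesis by (simp add: C_def algebra_simps)
    qed
  qed
qed

text \<open>The three parts of the quadrature rule are each bounded by the full sum over \<open>i < n\<close>, with the
  weights \<open>k/2\<close>, \<open>k\<close> and \<open>k/2\<close>; together they give the constant 2.\<close>

lemma history_discr_stable:
  fixes R :: "'x::banach \<Rightarrow>\<^sub>L 'y::real_normed_vector"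
  assumes k: "k \<ge> 0" and Q: "\<And>i. i < n \<Longrightarrow> norm (q (real n * k, real i * k)) \<le> Q"
  shows "norm (history_discr R q aS k n v - history_discr R q aS k n w)
    \<le> 2 * norm R * Q * (k * (\<Sum>i<n. norm (v i - w i)))"
proof (cases n)
  case 0
  then show ?thesis by (simp add: history_discr_def)
next
  case (Suc p)
  define d where "d = (\<lambda>i. q (real n * k, real i * k) (v i - w i))"
  define \<Sigma> where "\<Sigma> = (\<Sum>i<n. norm (v i - w i))"
  have d: "norm (d i) \<le> Q * norm (v i - w i)" if "i < n" for i
    unfolding d_def using order_trans[OF norm_blinfun mult_right_mono[OF Q[OF that]]] by simp
  have Q0: "Q \<ge> 0" using Q[of 0] Suc order_trans[OF norm_ge_zero] by blast
  have single: "norm (d i) \<le> Q * \<Sigma>" if "i < n" for i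
    using d[OF that] mult_left_mono[OF member_le_sum[of i "{..<n}" "\<lambda>i. norm (v i - w i)"] Q0] that
    unfolding \<Sigma>_def by auto
  have "norm (\<Sum>i=1..p. d i) \<le> (\<Sum>i=1..p. Q * norm (v i - w i))"
    by (rule sum_norm_le) (use d Suc in auto)
  also have "\<dots> \<le> (\<Sum>i<n. Q * norm (v i - w i))"
    by (rule sum_mono2) (use Suc Q0 in auto)
  finally have mid: "norm (\<Sum>i=1..p. d i) \<le> Q * \<Sigma>" by (simp add: \<Sigma>_def sum_distrib_left)
  have "history_discr R q aS k n v - history_discr R q aS k n w
      = R ((k / 2) *\<^sub>R d 0 + k *\<^sub>R (\<Sum>i=1..p. d i) + (k / 2) *\<^sub>R d p)"
    unfolding history_discr_def Let_def d_def
    by (simp add: Suc blinfun.diff_right scaleR_diff_right sum_subtractf flip: blinfun.diff_right)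
       (simp add: blinfun.diff_right blinfun.add_right sum_subtractf algebra_simps)
  also have "norm \<dots> \<le> norm R * norm ((k / 2) *\<^sub>R d 0 + k *\<^sub>R (\<Sum>i=1..p. d i) + (k / 2) *\<^sub>R d p)"
    by (rule norm_blinfun)
  also have "\<dots> \<le> norm R * ((k / 2) * (Q * \<Sigma>) + k * (Q * \<Sigma>) + (k / 2) * (Q * \<Sigma>))"
    using k mid single[of 0] single[of p] Suc
    by (intro mult_left_mono norm_triangle_mono) (auto intro!: mult_left_mono)
  finally show ?thesis by (simp add: \<Sigma>_def algebra_simps)
qed

section \<open>The inequality for one time step\<close>

text \<open>Here \<open>a\<close> is the exact and \<open>b\<close> the discrete solution at one time, \<open>w\<close> is the argument at which the
  explicit terms are evaluated, and \<open>v\<close> is any competitor. The parameters \<open>\<mu>\<close> and \<open>\<alpha>c\<close> serve the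
  two kinds of steps at once: the extrapolated scheme has \<open>\<mu> = \<alpha>j\<close>, so that the term with
  \<open>\<alpha>j - \<mu>\<close> vanishes, and the starting steps have \<open>jc = 0\<close>, \<open>\<mu> = 0\<close> and \<open>w = b\<close>.\<close>

lemma step_inequality:
  fixes \<gamma> :: "'x::banach \<Rightarrow>\<^sub>L 'z::banach"
    and A :: "'x \<Rightarrow> ('x \<Rightarrow>\<^sub>L real)"
    and \<phi> :: "'y::real_normed_vector \<Rightarrow> 'x \<Rightarrow> 'x \<Rightarrow> real"
    and jc :: "'z \<Rightarrow> ('z \<Rightarrow>\<^sub>L real)"
    and F :: "'x \<Rightarrow>\<^sub>L real"
  assumes cj: "cj > 0" "\<And>v. norm (\<gamma> v) \<le> cj * norm v"
    and A_lipschitz: "LA-lipschitz_on UNIV A"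
    and A_monotone: "\<And>v1 v2. (A v1 - A v2) (v1 - v2) \<ge> mA * (norm (v1 - v2))\<^sup>2"
    and \<phi>_bound: "\<alpha>\<phi> \<ge> 0" "\<beta>\<phi> \<ge> 0"
      "\<And>y1 y2 u1 u2 v1 v2.
         \<phi> y1 u1 v2 - \<phi> y1 u1 v1 + \<phi> y2 u2 v1 - \<phi> y2 u2 v2
           \<le> \<alpha>\<phi> * norm (u1 - u2) * norm (v1 - v2) + \<beta>\<phi> * norm (y1 - y2) * norm (v1 - v2)"
    and j: "locally_lipschitz j"
    and growth: "c1 \<ge> 0" "\<And>z \<xi>. \<xi> \<in> clarke_subdiff j z \<Longrightarrow> norm \<xi> \<le> c0 + c1 * norm z"
    and relaxed: "\<And>z1 z2. clarke_deriv j z1 (z2 - z1) + clarke_deriv j z2 (z1 - z2)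
                  \<le> \<alpha>j * (norm (z1 - z2))\<^sup>2"
    and jc: "linear jc" "\<alpha>c \<ge> 0" "\<And>z. norm (jc z) \<le> \<alpha>c * norm z" "\<And>z. jc z z \<ge> \<mu> * (norm z)\<^sup>2"
    and \<mu>: "\<mu> \<le> \<alpha>j"
    and midpoint: "\<And>y w v1 v2. \<phi> y w v1 + \<phi> y w v2 - 2 * \<phi> y w ((1/2) *\<^sub>R (v1 + v2))
                      \<le> c\<phi> * (norm (v1 - v2))\<^sup>2"
    and exact: "\<And>v. A a (v - a) + \<phi> y a v - \<phi> y a a + clarke_deriv j (\<gamma> a) (\<gamma> v - \<gamma> a) \<ge> F (v - a)"
    and discrete: "A b (v - b) + \<phi> y' w v - \<phi> y' w b + clarke_deriv j (\<gamma> b) (\<gamma> v - \<gamma> b)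
       + jc (\<gamma> b) (\<gamma> v - \<gamma> b) \<ge> F (v - b) + jc (\<gamma> w) (\<gamma> v - \<gamma> b)"
    and U: "norm (\<gamma> a) \<le> U"
  defines "E \<equiv> norm (a - b)" and "d \<equiv> norm (a - v)" and "e \<equiv> norm (a - w)" and "\<sigma> \<equiv> norm (y - y')"
    and "g \<equiv> norm (\<gamma> a - \<gamma> v)"
  shows "mA * E\<^sup>2 \<le> (\<alpha>\<phi> * e + \<beta>\<phi> * \<sigma>) * (E + d) + LA * E * d + 4 * c\<phi> * d\<^sup>2 + 2 * ((c0 + c1 * U) * g)
      + c1 * cj\<^sup>2 * E * d + (\<alpha>j - \<mu>) * cj\<^sup>2 * E\<^sup>2 + \<alpha>c * cj\<^sup>2 * (e * E + (E + e) * d)"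
proof -
  have nonneg: "E \<ge> 0" "d \<ge> 0" "e \<ge> 0" "\<sigma> \<ge> 0" "g \<ge> 0" by (auto simp: E_def d_def e_def \<sigma>_def g_def)
  have \<gamma>E: "norm (\<gamma> (a - b)) \<le> cj * E" and \<gamma>d: "norm (\<gamma> (v - a)) \<le> cj * d"
    and \<gamma>e: "norm (\<gamma> (a - w)) \<le> cj * e"
    using cj(2)[of "a - b"] cj(2)[of "v - a"] cj(2)[of "a - w"]
    by (simp_all add: E_def d_def e_def norm_minus_commute)
  have vb: "norm (v - b) \<le> E + d"
    using norm_triangle_ineq4[of "a - b" "a - v"] by (simp add: E_def d_def)
  \<comment> \<open>The reflection of \<open>v\<close> at \<open>a\<close>: testing the exact inequality with it bounds \<open>\<langle>A a - F, v - a\<rangle>\<close> from above,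
    and \<open>a\<close> is the midpoint of \<open>v\<close> and \<open>r\<close>.\<close>
  define r where "r = 2 *\<^sub>R a - v"
  have r: "r - a = a - v" "(1/2) *\<^sub>R (v + r) = a" "v - r = 2 *\<^sub>R (v - a)" "\<gamma> r - \<gamma> a = \<gamma> a - \<gamma> v"
    by (simp_all add: r_def scaleR_2 blinfun.diff_right blinfun.add_right)
  have mono: "(A a - A b) (a - b) \<ge> mA * E\<^sup>2" unfolding E_def by (rule A_monotone)
  have lip: "(A b - A a) (v - a) \<le> LA * E * d"
  proof -
    have "(A b - A a) (v - a) \<le> norm (A b - A a) * norm (v - a)"
      using norm_blinfun[of "A b - A a" "v - a"] by simp
    also have "\<dots> \<le> (LA * E) * d"
      using lipschitz_onD[OF A_lipschitz, of b a] lipschitz_on_nonneg[OF A_lipschitz]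
      by (intro mult_mono) (auto simp: dist_norm E_def d_def norm_minus_commute)
    finally show ?thesis by simp
  qed
  have \<phi>1: "\<phi> y a b - \<phi> y a v + \<phi> y' w v - \<phi> y' w b \<le> (\<alpha>\<phi> * e + \<beta>\<phi> * \<sigma>) * (E + d)"
  proof -
    have "\<phi> y a b - \<phi> y a v + \<phi> y' w v - \<phi> y' w b \<le> (\<alpha>\<phi> * e + \<beta>\<phi> * \<sigma>) * norm (v - b)"
      using \<phi>_bound(3)[of y a b v y' w] by (simp add: e_def \<sigma>_def distrib_right)
    also have "\<dots> \<le> (\<alpha>\<phi> * e + \<beta>\<phi> * \<sigma>) * (E + d)"
      using vb nonneg \<phi>_bound(1,2) by (intro mult_left_mono) auto
    finally show ?thesis .
  qed
  have \<phi>2: "\<phi> y a v + \<phi> y a r - 2 * \<phi> y a a \<le> 4 * c\<phi> * d\<^sup>2"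
    using midpoint[of y a v r] unfolding r(2,3)
    by (simp add: d_def norm_minus_commute power_mult_distrib mult_ac)
  have j1: "clarke_deriv j (\<gamma> a) (\<gamma> a - \<gamma> v) \<le> (c0 + c1 * U) * g"
  proof -
    have "clarke_deriv j (\<gamma> a) (\<gamma> a - \<gamma> v) \<le> (c0 + c1 * norm (\<gamma> a)) * g"
      unfolding g_def by (rule clarke_deriv_growth[OF j growth(2)])
    also have "\<dots> \<le> (c0 + c1 * U) * g"
      using U growth(1) nonneg by (intro mult_right_mono add_left_mono mult_left_mono) auto
    finally show ?thesis .
  qed
  have j2: "clarke_deriv j (\<gamma> b) (\<gamma> v - \<gamma> b)
      \<le> clarke_deriv j (\<gamma> b) (\<gamma> v - \<gamma> a) + clarke_deriv j (\<gamma> b) (\<gamma> a - \<gamma> b)"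
    using sublinearD(1)[OF sublinear_clarke_deriv[OF j], of "\<gamma> b" "\<gamma> v - \<gamma> a" "\<gamma> a - \<gamma> b"] by simp
  have j3: "clarke_deriv j (\<gamma> b) (\<gamma> v - \<gamma> a) \<le> (c0 + c1 * U) * g + c1 * cj\<^sup>2 * E * d"
  proof -
    have "clarke_deriv j (\<gamma> b) (\<gamma> v - \<gamma> a) \<le> (c0 + c1 * norm (\<gamma> b)) * g"
      unfolding g_def norm_minus_commute[of "\<gamma> a"] by (rule clarke_deriv_growth[OF j growth(2)])
    also have "\<dots> \<le> (c0 + c1 * (U + cj * E)) * g"
    proof -
      have "norm (\<gamma> b) \<le> norm (\<gamma> a) + norm (\<gamma> (a - b))"
        using norm_triangle_ineq4[of "\<gamma> a" "\<gamma> (a - b)"] by (simp add: blinfun.diff_right)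
      then have "norm (\<gamma> b) \<le> U + cj * E" using U \<gamma>E by linarith
      then show ?thesis
        using growth(1) nonneg by (intro mult_right_mono add_left_mono mult_left_mono) auto
    qed
    also have "\<dots> = (c0 + c1 * U) * g + (c1 * cj * E) * g" by (simp add: algebra_simps)
    also have "(c1 * cj * E) * g \<le> (c1 * cj * E) * (cj * d)"
      using \<gamma>d growth(1) cj(1) nonneg
      by (intro mult_left_mono) (auto simp: g_def blinfun.diff_right norm_minus_commute)
    finally show ?thesis by (simp add: power2_eq_square mult_ac)
  qed
  have j4: "clarke_deriv j (\<gamma> a) (\<gamma> b - \<gamma> a) + clarke_deriv j (\<gamma> b) (\<gamma> a - \<gamma> b)
      \<le> \<alpha>j * (norm (\<gamma> (a - b)))\<^sup>2"
    using relaxed[of "\<gamma> a" "\<gamma> b"] by (simp add: blinfun.diff_right)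
  have bil: "jc (\<gamma> x1) (\<gamma> x2) \<le> \<alpha>c * cj\<^sup>2 * (t1 * t2)"
    if "norm (\<gamma> x1) \<le> cj * t1" "norm (\<gamma> x2) \<le> cj * t2" "t1 \<ge> 0" for x1 x2 t1 t2
  proof -
    have "jc (\<gamma> x1) (\<gamma> x2) \<le> norm (jc (\<gamma> x1)) * norm (\<gamma> x2)"
      using norm_blinfun[of "jc (\<gamma> x1)" "\<gamma> x2"] by simp
    also have "\<dots> \<le> (\<alpha>c * (cj * t1)) * (cj * t2)"
      using jc(2) cj(1) that
      by (intro mult_mono order_trans[OF jc(3)] mult_left_mono) auto
    finally show ?thesis by (simp add: power2_eq_square mult_ac)
  qed
  have jc1: "jc (\<gamma> (a - b)) (\<gamma> (a - b)) \<ge> \<mu> * (norm (\<gamma> (a - b)))\<^sup>2" by (rule jc(4))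
  have jc2: "jc (\<gamma> (a - w)) (\<gamma> (a - b)) \<le> \<alpha>c * cj\<^sup>2 * (e * E)"
    by (rule bil[OF \<gamma>e \<gamma>E nonneg(3)])
  have jc3: "jc (\<gamma> (b - w)) (\<gamma> (v - a)) \<le> \<alpha>c * cj\<^sup>2 * ((E + e) * d)"
  proof (rule bil[OF _ \<gamma>d])
    have "norm (\<gamma> (b - w)) \<le> norm (\<gamma> (a - w)) + norm (\<gamma> (a - b))"
      using norm_triangle_ineq4[of "\<gamma> (a - w)" "\<gamma> (a - b)"] by (simp add: blinfun.diff_right)
    then show "norm (\<gamma> (b - w)) \<le> cj * (E + e)" using \<gamma>E \<gamma>e by (simp add: distrib_left)
    show "0 \<le> E + e" using nonneg by simp
  qed
  \<comment> \<open>With \<open>b - w = (a - w) - (a - b)\<close> and \<open>v - b = (v - a) + (a - b)\<close>; the first term is the coercive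
    one.\<close>
  have jcsum: "jc (\<gamma> b) (\<gamma> v - \<gamma> b) - jc (\<gamma> w) (\<gamma> v - \<gamma> b)
      = - jc (\<gamma> (a - b)) (\<gamma> (a - b)) + jc (\<gamma> (a - w)) (\<gamma> (a - b)) + jc (\<gamma> (b - w)) (\<gamma> (v - a))"
    by (simp add: blinfun.diff_right blinfun.diff_left linear_diff[OF jc(1)])
  have sq: "(\<alpha>j - \<mu>) * (norm (\<gamma> (a - b)))\<^sup>2 \<le> (\<alpha>j - \<mu>) * cj\<^sup>2 * E\<^sup>2"
  proof -
    have "(norm (\<gamma> (a - b)))\<^sup>2 \<le> (cj * E)\<^sup>2" by (rule power_mono[OF \<gamma>E]) simp
    then show ?thesis using \<mu> mult_left_mono[of _ "(cj * E)\<^sup>2" "\<alpha>j - \<mu>"]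
      by (simp add: power_mult_distrib mult.assoc)
  qed
  have A: "A a (b - a) = - (A a) (a - b)" "(A a - A b) (a - b) = A a (a - b) - A b (a - b)"
    "A b (v - b) = A b (v - a) + A b (a - b)" "(A b - A a) (v - a) = A b (v - a) - A a (v - a)"
    "A a (a - v) = - A a (v - a)" "F (a - v) = - F (v - a)" "F (b - a) = - F (a - b)"
    "F (v - b) = F (v - a) + F (a - b)"
    by (simp_all add: blinfun.diff_right blinfun.diff_left)
  \<comment> \<open>Names for the nonlinear expressions, so that the summation of all estimates is a linear problem.\<close>
  define p1 p2 p3 p4 p5 where "p1 = (\<alpha>\<phi> * e + \<beta>\<phi> * \<sigma>) * (E + d)" and "p2 = LA * E * d"
    and "p3 = 4 * c\<phi> * d\<^sup>2" and "p4 = (c0 + c1 * U) * g" and "p5 = c1 * cj\<^sup>2 * E * d"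
  define n1 n2 n3 n4 m where "n1 = \<alpha>j * (norm (\<gamma> (a - b)))\<^sup>2" and "n2 = \<mu> * (norm (\<gamma> (a - b)))\<^sup>2"
    and "n3 = \<alpha>c * cj\<^sup>2 * (e * E)" and "n4 = \<alpha>c * cj\<^sup>2 * ((E + e) * d)" and "m = mA * E\<^sup>2"
  note abbr = p1_def p2_def p3_def p4_def p5_def n1_def n2_def n3_def n4_def m_def
  have e1: "A a (b - a) + \<phi> y a b - \<phi> y a a + clarke_deriv j (\<gamma> a) (\<gamma> b - \<gamma> a) \<ge> F (b - a)"
    by (rule exact)
  have e2: "A a (a - v) + \<phi> y a r - \<phi> y a a + clarke_deriv j (\<gamma> a) (\<gamma> a - \<gamma> v) \<ge> F (a - v)"
    using exact[of r] unfolding r .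
  have "m \<le> p1 + p2 + p3 + 2 * p4 + p5 + (n1 - n2) + (n3 + n4)"
    using e1[unfolded A] e2[unfolded A] discrete[unfolded A] mono[unfolded A, folded abbr]
      lip[unfolded A, folded abbr] \<phi>1[folded abbr] \<phi>2[folded abbr] j1[folded abbr] j2
      j3[folded abbr] j4[folded abbr] jc1[folded abbr] jc2[folded abbr] jc3[folded abbr] jcsum
    by linarith
  moreover define x1 x2 where "x1 = (\<alpha>j - \<mu>) * cj\<^sup>2 * E\<^sup>2" and "x2 = \<alpha>c * cj\<^sup>2 * (e * E + (E + e) * d)"
  moreover have "n1 - n2 \<le> x1"
    using sq by (simp add: n1_def n2_def x1_def left_diff_distrib)
  moreover have "n3 + n4 = x2"
    by (simp add: n3_def n4_def x2_def distrib_left)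
  ultimately have "m \<le> p1 + p2 + p3 + 2 * p4 + p5 + x1 + x2" by linarith
  then show ?thesis unfolding p1_def p2_def p3_def p4_def p5_def m_def x1_def x2_def .
qed

section \<open>From the step inequality to a global bound\<close>

text \<open>The coefficient of \<open>e\<close> has to stay close to \<open>a / m\<close>, because contraction depends on it. The mixed
  term \<open>a e d\<close> is therefore split by Young's inequality with a small weight \<open>\<epsilon>\<close> on \<open>e\<close>, and the large
  weight falls on \<open>d\<close>. The linear term \<open>g\<close> enters through its root.\<close>

lemma quadratic_estimate:
  fixes m a \<beta> K K2 K3 \<epsilon> :: real
  assumes m: "m > 0" and nonneg: "a \<ge> 0" "\<beta> \<ge> 0" "K \<ge> 0" "K2 \<ge> 0" "K3 \<ge> 0" and \<epsilon>: "\<epsilon> > 0"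
  obtains C where "C > 0"
    "\<And>E e \<sigma> d g. E \<ge> 0 \<Longrightarrow> e \<ge> 0 \<Longrightarrow> \<sigma> \<ge> 0 \<Longrightarrow> d \<ge> 0 \<Longrightarrow> g \<ge> 0 \<Longrightarrow>
      m * E\<^sup>2 \<le> (a * e + \<beta> * \<sigma> + K * d) * E + (a * e * d + \<beta> * \<sigma> * d + K2 * d\<^sup>2 + K3 * g) \<Longrightarrow>
      E \<le> (a / m + \<epsilon>) * e + C * (\<sigma> + (d + sqrt g))"
proof -
  \<comment> \<open>Large enough that \<open>m (\<epsilon> e + \<sigma> + B (d + sqrt g))\<^sup>2\<close> dominates the terms without the factor \<open>E\<close>.\<close>
  define B where "B = a / (2 * \<epsilon> * m) + \<beta> / (2 * m) + K2 / m + K3 / m + 1"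
  have parts: "0 \<le> a / (2 * \<epsilon> * m)" "0 \<le> \<beta> / (2 * m)" "0 \<le> K2 / m" "0 \<le> K3 / m"
    using m nonneg \<epsilon> by auto
  have B1: "B \<ge> 1" and Ba: "a / (2 * \<epsilon> * m) \<le> B" and Bb: "\<beta> / (2 * m) \<le> B"
    and Bc: "K2 / m \<le> B" and Bd: "K3 / m \<le> B"
    using parts unfolding B_def by linarith+
  have BB: "B \<le> B\<^sup>2" using B1 by (simp add: power2_eq_square)
  have ca: "a \<le> 2 * \<epsilon> * B * m" and cb: "\<beta> \<le> 2 * B * m" and cc: "K2 \<le> B * m" and cd: "K3 \<le> B * m"
    using Ba Bb Bc Bd m \<epsilon> by (auto simp: field_simps)
  have BBm: "B * m \<le> B\<^sup>2 * m" using BB m by (intro mult_right_mono) auto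
  define C where "C = \<beta> / m + K / m + B + 1"
  have Kp: "0 \<le> \<beta> / m" "0 \<le> K / m" using m nonneg by auto
  show ?thesis
  proof (rule that[of C])
    show "C > 0" using Kp B1 unfolding C_def by linarith
    fix E e \<sigma> d g :: real
    assume p: "E \<ge> 0" "e \<ge> 0" "\<sigma> \<ge> 0" "d \<ge> 0" "g \<ge> 0"
      and q: "m * E\<^sup>2 \<le> (a * e + \<beta> * \<sigma> + K * d) * E + (a * e * d + \<beta> * \<sigma> * d + K2 * d\<^sup>2 + K3 * g)"
    define h where "h = sqrt g"
    have h: "h \<ge> 0" "g = h\<^sup>2" using p by (auto simp: h_def)
    define s where "s = \<epsilon> * e + \<sigma> + B * (d + h)"
    define P where "P = a * e + \<beta> * \<sigma> + K * d"
    have s: "s \<ge> 0" and P: "P \<ge> 0" using p h \<epsilon> B1 nonneg by (auto simp: s_def P_def)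
    have "a * e * d + \<beta> * \<sigma> * d + K2 * d\<^sup>2 + K3 * g
      \<le> (2 * \<epsilon> * B * m) * e * d + (2 * B * m) * \<sigma> * d + (B\<^sup>2 * m) * d\<^sup>2 + (B\<^sup>2 * m) * g"
      using ca cb cc cd BBm p by (intro add_mono mult_right_mono) auto
    also have "\<dots> = m * (2 * (\<epsilon> * e) * (B * d) + 2 * \<sigma> * (B * d) + (B * d)\<^sup>2 + (B * h)\<^sup>2)"
      unfolding h(2) by (simp add: power2_eq_square algebra_simps)
    also have "\<dots> \<le> m * s\<^sup>2"
    proof -
      have "s\<^sup>2 - (2 * (\<epsilon> * e) * (B * d) + 2 * \<sigma> * (B * d) + (B * d)\<^sup>2 + (B * h)\<^sup>2)
         = (\<epsilon> * e + \<sigma>)\<^sup>2 + 2 * (\<epsilon> * e + \<sigma>) * (B * h) + 2 * (B * d) * (B * h)"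
        by (simp add: s_def power2_eq_square algebra_simps)
      also have "\<dots> \<ge> 0" using p h \<epsilon> B1 by (intro add_nonneg_nonneg mult_nonneg_nonneg) auto
      finally show ?thesis using m by (intro mult_left_mono) auto
    qed
    finally have Q: "m * E\<^sup>2 \<le> P * E + m * s\<^sup>2" using q unfolding P_def by linarith
    have "E \<le> P / m + s"
    proof (rule ccontr)
      assume "\<not> E \<le> P / m + s"
      then have big: "E > P / m + s" by simp
      then have "m * E > P + m * s" using m by (simp add: field_simps)
      moreover have "E > s" "E > 0" using big P m s divide_nonneg_pos[OF P m] by linarith+
      ultimately have "(m * E) * E > (P + m * s) * E" by simp
      moreover have "m * s * E \<ge> m * s * s" using \<open>E > s\<close> m s by (intro mult_left_mono) auto
      ultimately show False using Q by (simp add: power2_eq_square algebra_simps)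
    qed
    also have "P / m + s = (a / m + \<epsilon>) * e + ((\<beta> / m + 1) * \<sigma> + (K / m + B) * d + B * h)"
      using m by (simp add: P_def s_def field_simps)
    also have "(\<beta> / m + 1) * \<sigma> + (K / m + B) * d + B * h \<le> C * \<sigma> + C * d + C * h"
      using p h Kp B1 by (intro add_mono mult_right_mono) (auto simp: C_def)
    finally show "E \<le> (a / m + \<epsilon>) * e + C * (\<sigma> + (d + sqrt g))"
      by (simp add: h_def algebra_simps)
  qed
qed

text \<open>Induction proves \<open>E n \<le> B \<rho>\<^sup>n\<close> for \<open>\<rho> = 1 + \<kappa> k\<close>. The two-step term takes the share \<open>\<theta>\<close> of this
  bound, since \<open>2 + 1 = 3\<close>. The remaining \<open>1 - \<theta>\<close> is divided equally: \<open>\<kappa>\<close> is chosen such that the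
  geometric sum fits into one half, and \<open>B\<close> such that \<open>X\<close> fits into the other.\<close>

lemma two_step_gronwall:
  fixes E :: "nat \<Rightarrow> real"
  assumes nonneg: "\<And>n. E n \<ge> 0" and \<theta>: "0 \<le> \<theta>" "\<theta> < 1" and K: "K > 0" and k: "k \<ge> 0" "real N * k \<le> T"
    and X: "X \<ge> 0"
    and step: "\<And>n. n \<le> N \<Longrightarrow>
      E n \<le> (if 2 \<le> n then \<theta> / 3 * (2 * E (n - 1) + E (n - 2)) else 0) + K * (k * (\<Sum>i<n. E i)) + X"
    and n: "n \<le> N"
  shows "E n \<le> 2 / (1 - \<theta>) * exp (2 * K / (1 - \<theta>) * T) * X"
proof -
  define \<kappa> where "\<kappa> = 2 * K / (1 - \<theta>)"
  define \<rho> where "\<rho> = 1 + \<kappa> * k"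
  define B where "B = 2 * X / (1 - \<theta>)"
  have \<kappa>: "\<kappa> > 0" and B: "B \<ge> 0" using K \<theta> X by (auto simp: \<kappa>_def B_def)
  have \<rho>: "\<rho> \<ge> 1" using \<kappa> k by (simp add: \<rho>_def)
  have claim: "E n \<le> B * \<rho> ^ n" if "n \<le> N" for n
    using that
  proof (induction n rule: less_induct)
    case (less n)
    have IH: "E i \<le> B * \<rho> ^ i" if "i < n" for i using less that by auto
    have E\<rho>: "E i \<le> B * \<rho> ^ n" if "i < n" for i
      using IH[OF that] mult_left_mono[OF power_increasing[of i n \<rho>] B] \<rho> that by simp
    have first: "(if 2 \<le> n then \<theta> / 3 * (2 * E (n - 1) + E (n - 2)) else 0) \<le> \<theta> * (B * \<rho> ^ n)"
    proof (cases "2 \<le> n")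
      case True
      have "\<theta> / 3 * (2 * E (n - 1) + E (n - 2)) \<le> \<theta> / 3 * (3 * (B * \<rho> ^ n))"
        using E\<rho>[of "n - 1"] E\<rho>[of "n - 2"] True \<theta> by (intro mult_left_mono) auto
      then show ?thesis using True by simp
    next
      case False
      then show ?thesis using \<theta> B \<rho> by simp
    qed
    have "\<kappa> * (k * (\<Sum>i<n. E i)) \<le> \<kappa> * (k * (\<Sum>i<n. B * \<rho> ^ i))"
      using \<kappa> k IH by (intro mult_left_mono sum_mono) auto
    also have "\<dots> = B * ((\<rho> - 1) * (\<Sum>i<n. \<rho> ^ i))"
      by (simp add: \<rho>_def sum_distrib_left mult_ac)
    also have "(\<rho> - 1) * (\<Sum>i<n. \<rho> ^ i) = \<rho> ^ n - 1"
      by (simp add: power_diff_1_eq)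
    also have "B * (\<rho> ^ n - 1) \<le> B * \<rho> ^ n" using B by (simp add: mult_left_mono)
    finally have "\<kappa> * (k * (\<Sum>i<n. E i)) \<le> B * \<rho> ^ n" .
    then have second: "K * (k * (\<Sum>i<n. E i)) \<le> (1 - \<theta>) / 2 * (B * \<rho> ^ n)"
      using \<theta> K by (simp add: \<kappa>_def field_simps)
    have "B * 1 \<le> B * \<rho> ^ n" using B \<rho> by (intro mult_left_mono one_le_power) auto
    then have "(1 - \<theta>) / 2 * B \<le> (1 - \<theta>) / 2 * (B * \<rho> ^ n)" using \<theta> by (intro mult_left_mono) auto
    then have third: "X \<le> (1 - \<theta>) / 2 * (B * \<rho> ^ n)" using \<theta> by (simp add: B_def)
    have "E n \<le> \<theta> * (B * \<rho> ^ n) + (1 - \<theta>) / 2 * (B * \<rho> ^ n) + (1 - \<theta>) / 2 * (B * \<rho> ^ n)"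
      using step[OF less.prems] first second third by linarith
    also have "\<dots> = B * \<rho> ^ n" by (simp add: field_simps)
    finally show ?case .
  qed
  have "\<rho> ^ n \<le> exp (\<kappa> * k) ^ n"
    using \<rho> by (intro power_mono) (auto simp: \<rho>_def)
  also have "\<dots> = exp (\<kappa> * (real n * k))" by (simp flip: exp_of_nat_mult add: mult_ac)
  also have "\<dots> \<le> exp (\<kappa> * T)"
    using \<kappa> k n mult_right_mono[of "real n" "real N" k] by simp
  finally have "B * \<rho> ^ n \<le> B * exp (\<kappa> * T)" using B by (intro mult_left_mono) auto
  then show ?thesis using claim[OF n] by (simp add: B_def \<kappa>_def mult_ac)
qed

lemma le_cINF_affine:
  fixes F :: "'a \<Rightarrow> real"
  assumes "V \<noteq> {}" "C > 0" "\<And>v. v \<in> V \<Longrightarrow> E \<le> A + C * F v"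
  shows "E \<le> A + C * (INF v\<in>V. F v)"
proof -
  have "(E - A) / C \<le> (INF v\<in>V. F v)"
    by (rule cINF_greatest[OF assms(1)]) (use assms(2) assms(3) in \<open>auto simp: field_simps\<close>)
  then show ?thesis using assms(2) by (simp add: field_simps)
qed

section \<open>The error estimate\<close>

theorem theorem24:
  fixes \<gamma> :: "'x::banach \<Rightarrow>\<^sub>L 'z::banach"
    and A :: "'x \<Rightarrow> ('x \<Rightarrow>\<^sub>L real)"
    and \<phi> :: "'y::real_normed_vector \<Rightarrow> 'x \<Rightarrow> 'x \<Rightarrow> real"
    and j :: "'z \<Rightarrow> real"
    and jc :: "'z \<Rightarrow> ('z \<Rightarrow>\<^sub>L real)"
    and f :: "real \<Rightarrow> ('x \<Rightarrow>\<^sub>L real)"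
    and R :: "'x \<Rightarrow>\<^sub>L 'y"
    and q :: "real \<times> real \<Rightarrow> ('x \<Rightarrow>\<^sub>L 'x)"
    and aS :: 'x
    and u :: "real \<Rightarrow> 'x"
    and H :: "real set"
    and Xh :: "real \<Rightarrow> 'x set"
    and cj LA mA \<alpha>\<phi> \<beta>\<phi> c0 c1 \<alpha>j \<alpha>c c\<phi> T :: real
  assumes X_reflexive: "reflexive_space TYPE('x)"
    and cj: "cj > 0" "\<And>v. norm (\<gamma> v) \<le> cj * norm v"
    and A_lipschitz: "LA > 0" "LA-lipschitz_on UNIV A"
    and A_monotone: "mA > 0" "\<And>v1 v2. (A v1 - A v2) (v1 - v2) \<ge> mA * (norm (v1 - v2))\<^sup>2"
    and \<phi>_convex: "\<And>y w. convex_on UNIV (\<phi> y w)"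
    and \<phi>_lsc: "\<And>y w. lower_semicontinuous (\<phi> y w)"
    and \<phi>_bound: "\<alpha>\<phi> > 0" "\<beta>\<phi> > 0"
      "\<And>y1 y2 u1 u2 v1 v2.
         \<phi> y1 u1 v2 - \<phi> y1 u1 v1 + \<phi> y2 u2 v1 - \<phi> y2 u2 v2
           \<le> \<alpha>\<phi> * norm (u1 - u2) * norm (v1 - v2) + \<beta>\<phi> * norm (y1 - y2) * norm (v1 - v2)"
    and j_lipschitz: "locally_lipschitz j"
    and j_growth: "c0 \<ge> 0" "c1 \<ge> 0"
      "\<And>z \<xi>. \<xi> \<in> clarke_subdiff j z \<Longrightarrow> norm \<xi> \<le> c0 + c1 * norm z"
    and j_relaxed: "\<alpha>j > 0"
      "\<And>z1 z2. clarke_deriv j z1 (z2 - z1) + clarke_deriv j z2 (z1 - z2)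
                  \<le> \<alpha>j * (norm (z1 - z2))\<^sup>2"
    and f_continuous: "continuous_on {0..} f"
    and q_continuous: "continuous_on ({0..} \<times> {0..}) q"
    and jc_linear: "linear jc"
    and jc_bound: "\<alpha>c \<ge> 0" "\<And>z. norm (jc z) \<le> \<alpha>c * norm z"
    and jc_coercive: "\<And>z. jc z z \<ge> \<alpha>j * (norm z)\<^sup>2"
    and small1: "\<alpha>\<phi> + \<alpha>j * cj\<^sup>2 < mA"
    and small2: "\<alpha>\<phi> + \<alpha>c * cj\<^sup>2 < mA / 3"
    and \<phi>_midpoint: "c\<phi> > 0"
      "\<And>y w v1 v2. \<phi> y w v1 + \<phi> y w v2 - 2 * \<phi> y w ((1/2) *\<^sub>R (v1 + v2))
                      \<le> c\<phi> * (norm (v1 - v2))\<^sup>2"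
    and q_C2: "C2_on ({0..} \<times> {0..}) q"
    and u_continuous: "continuous_on {0..} u"
    and u_solution:
      "\<And>t v. t \<ge> 0 \<Longrightarrow>
         A (u t) (v - u t)
         + \<phi> (history_op R q aS u t) (u t) v - \<phi> (history_op R q aS u t) (u t) (u t)
         + clarke_deriv j (\<gamma> (u t)) (\<gamma> v - \<gamma> (u t))
         \<ge> f t (v - u t)"
    and u_regular: "W2inf_loc u"
    and T: "T > 0"
    and mesh_sizes: "H \<subseteq> {0<..}"
    and Xh_subspace: "\<And>h. h \<in> H \<Longrightarrow> subspace (Xh h)"
    and Xh_finite_dim: "\<And>h. h \<in> H \<Longrightarrow> \<exists>B. finite B \<and> Xh h = span B"
  shows "\<exists>C>0. \<forall>N::nat. \<forall>k. \<forall>h\<in>H. \<forall>w :: nat \<Rightarrow> 'x.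
    N > 0 \<longrightarrow> k = T / real N \<longrightarrow>
    (\<forall>n\<le>N. w n \<in> Xh h) \<longrightarrow>
    (\<forall>n. 2 \<le> n \<and> n \<le> N \<longrightarrow> (\<forall>v\<in>Xh h.
       A (w n) (v - w n)
       + \<phi> (history_discr R q aS k n w) (2 *\<^sub>R w (n - 1) - w (n - 2)) v
       - \<phi> (history_discr R q aS k n w) (2 *\<^sub>R w (n - 1) - w (n - 2)) (w n)
       + clarke_deriv j (\<gamma> (w n)) (\<gamma> v - \<gamma> (w n))
       + jc (\<gamma> (w n)) (\<gamma> v - \<gamma> (w n))
       \<ge> f (real n * k) (v - w n)
         + jc (2 *\<^sub>R \<gamma> (w (n - 1)) - \<gamma> (w (n - 2))) (\<gamma> v - \<gamma> (w n)))) \<longrightarrow>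
    (\<forall>n\<in>{0, 1}. \<forall>v\<in>Xh h.
       A (w n) (v - w n)
       + \<phi> (history_discr R q aS k n w) (w n) v
       - \<phi> (history_discr R q aS k n w) (w n) (w n)
       + clarke_deriv j (\<gamma> (w n)) (\<gamma> v - \<gamma> (w n))
       \<ge> f (real n * k) (v - w n)) \<longrightarrow>
    (MAX n\<in>{0..N}. norm (u (real n * k) - w n))
      \<le> C * ((MAX n\<in>{0..N}. INF v\<in>Xh h.
                 norm (u (real n * k) - v) + sqrt (norm (\<gamma> (u (real n * k)) - \<gamma> v)))
              + k\<^sup>2)"
proof -
  have uT: "continuous_on {0..T} u" using u_continuous by (rule continuous_on_subset) auto
  have W: "W2inf T u" using u_regular T by (simp add: W2inf_loc_def)
  obtain M where M: "M \<ge> 0"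
    "\<And>m h. 0 \<le> h \<Longrightarrow> 0 \<le> m - h \<Longrightarrow> m + h \<le> T \<Longrightarrow> norm (u (m + h) - 2 *\<^sub>R u m + u (m - h)) \<le> M * h\<^sup>2"
    using W2inf_differences[OF uT W] by metis
  obtain Q where Q: "Q \<ge> 0" "\<And>t s. t \<in> {0..T} \<Longrightarrow> s \<in> {0..T} \<Longrightarrow> norm (q (t, s)) \<le> Q"
    using C2_kernel_differences[OF q_C2 less_imp_le[OF T]] by metis
  obtain Ch where Ch: "Ch \<ge> 0" "\<And>k n. k > 0 \<Longrightarrow> real n * k \<le> T \<Longrightarrow>
      norm (history_op R q aS u (real n * k) - history_discr R q aS k n (\<lambda>i. u (real i * k))) \<le> Ch * k\<^sup>2"
    using history_discr_consistent[where R=R and aS=aS, OF T u_continuous W q_continuous q_C2] by blast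
  obtain U0 where U0: "\<forall>s\<in>{0..T}. norm (u s) \<le> U0"
    using compact_imp_bounded[OF compact_continuous_image[OF uT compact_Icc]]
    by (auto simp: bounded_pos)
  define U where "U = cj * U0"
  have U: "norm (\<gamma> (u s)) \<le> U" if "s \<in> {0..T}" for s
    using order_trans[OF cj(2)[of "u s"] mult_left_mono[OF bspec[OF U0 that], of cj]] cj(1) by (simp add: U_def)
  have U_nonneg: "U \<ge> 0" using U[of 0] T order_trans[OF norm_ge_zero] by fastforce
  define G where "G = c0 + c1 * U"
  have G: "G \<ge> 0" using j_growth(1,2) U_nonneg by (simp add: G_def)
  have ccj: "0 \<le> c1 * cj\<^sup>2" "0 \<le> \<alpha>c * cj\<^sup>2" using j_growth(2) jc_bound(1) by auto

  define a where "a = \<alpha>\<phi> + \<alpha>c * cj\<^sup>2"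
  have a: "0 \<le> a" "3 * (a / mA) < 1" using small2 \<phi>_bound(1) ccj A_monotone(1) by (auto simp: a_def field_simps)
  \<comment> \<open>With this \<open>\<epsilon>\<close> the contraction factor \<open>\<theta>\<close> is the midpoint of \<open>3 a / mA\<close> and 1.\<close>
  define \<epsilon> where "\<epsilon> = (1 - 3 * (a / mA)) / 6"
  define \<theta> where "\<theta> = 3 * (a / mA + \<epsilon>)"
  have \<epsilon>: "\<epsilon> > 0" using a by (simp add: \<epsilon>_def)
  have "0 \<le> a / mA" using a(1) A_monotone(1) by simp
  then have \<theta>: "0 \<le> \<theta>" "\<theta> < 1" unfolding \<theta>_def \<epsilon>_def using a(2) by argo+
  have \<theta>3: "a / mA + \<epsilon> = \<theta> / 3" by (simp add: \<theta>_def)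
  obtain Ca where Ca: "Ca > 0"
    "\<And>E e \<sigma> d g. E \<ge> 0 \<Longrightarrow> e \<ge> 0 \<Longrightarrow> \<sigma> \<ge> 0 \<Longrightarrow> d \<ge> 0 \<Longrightarrow> g \<ge> 0 \<Longrightarrow>
      mA * E\<^sup>2 \<le> (a * e + \<beta>\<phi> * \<sigma> + (LA + c1 * cj\<^sup>2 + \<alpha>c * cj\<^sup>2) * d) * E
        + (a * e * d + \<beta>\<phi> * \<sigma> * d + (4 * c\<phi>) * d\<^sup>2 + (2 * G) * g) \<Longrightarrow>
      E \<le> (a / mA + \<epsilon>) * e + Ca * (\<sigma> + (d + sqrt g))"
    by (rule quadratic_estimate[of mA a \<beta>\<phi> "LA + c1 * cj\<^sup>2 + \<alpha>c * cj\<^sup>2" "4 * c\<phi>" "2 * G" \<epsilon>])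
      (use A_monotone(1) a \<phi>_bound(2) A_lipschitz(1) ccj \<phi>_midpoint(1) G \<epsilon> in auto)
  \<comment> \<open>The starting steps are implicit, so \<open>mA\<close> has to absorb both \<open>\<alpha>\<phi>\<close> and \<open>\<alpha>j cj\<^sup>2\<close>. There is no
    extrapolation term, and the estimate is used with \<open>a = 0\<close> and \<open>e = 0\<close>.\<close>
  define m0 where "m0 = mA - \<alpha>\<phi> - \<alpha>j * cj\<^sup>2"
  have m0: "m0 > 0" using small1 by (simp add: m0_def)
  obtain Cb where Cb: "Cb > 0"
    "\<And>E e \<sigma> d g. E \<ge> 0 \<Longrightarrow> e \<ge> 0 \<Longrightarrow> \<sigma> \<ge> 0 \<Longrightarrow> d \<ge> 0 \<Longrightarrow> g \<ge> 0 \<Longrightarrow>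
      m0 * E\<^sup>2 \<le> (0 * e + \<beta>\<phi> * \<sigma> + (\<alpha>\<phi> + LA + c1 * cj\<^sup>2) * d) * E
        + (0 * e * d + \<beta>\<phi> * \<sigma> * d + (4 * c\<phi>) * d\<^sup>2 + (2 * G) * g) \<Longrightarrow>
      E \<le> (0 / m0 + 1) * e + Cb * (\<sigma> + (d + sqrt g))"
    by (rule quadratic_estimate[of m0 0 \<beta>\<phi> "\<alpha>\<phi> + LA + c1 * cj\<^sup>2" "4 * c\<phi>" "2 * G" 1])
      (use m0 \<phi>_bound(1,2) A_lipschitz(1) ccj \<phi>_midpoint(1) G in auto)
  define Cm where "Cm = Ca + Cb"
  have Cm: "Cm > 0" "Ca \<le> Cm" "Cb \<le> Cm" using Ca(1) Cb(1) by (auto simp: Cm_def)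
  define K where "K = Cm * (2 * norm R * Q) + 1"
  have K: "K > 0" using Cm Q(1) by (simp add: K_def add_nonneg_pos)
  define D where "D = Cm + \<theta> / 3 * M + Cm * Ch"
  have D: "D > 0" "Cm \<le> D" using Cm \<theta> M(1) Ch(1) by (auto simp: D_def add_pos_nonneg)
  define C where "C = 2 / (1 - \<theta>) * exp (2 * K / (1 - \<theta>) * T) * D"
  show ?thesis
  proof (intro exI[of _ C] conjI allI ballI impI)
    show "C > 0" using D \<theta> by (simp add: C_def)
    fix N :: nat and k h :: real and w :: "nat \<Rightarrow> 'x"
    assume N: "N > 0" and k_def: "k = T / real N" and h: "h \<in> H"
      and wX: "\<forall>n\<le>N. w n \<in> Xh h"
      and scheme: "\<forall>n. 2 \<le> n \<and> n \<le> N \<longrightarrow> (\<forall>v\<in>Xh h.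
       A (w n) (v - w n)
       + \<phi> (history_discr R q aS k n w) (2 *\<^sub>R w (n - 1) - w (n - 2)) v
       - \<phi> (history_discr R q aS k n w) (2 *\<^sub>R w (n - 1) - w (n - 2)) (w n)
       + clarke_deriv j (\<gamma> (w n)) (\<gamma> v - \<gamma> (w n))
       + jc (\<gamma> (w n)) (\<gamma> v - \<gamma> (w n))
       \<ge> f (real n * k) (v - w n)
         + jc (2 *\<^sub>R \<gamma> (w (n - 1)) - \<gamma> (w (n - 2))) (\<gamma> v - \<gamma> (w n)))"
      and start: "\<forall>n\<in>{0, 1}. \<forall>v\<in>Xh h.
       A (w n) (v - w n)
       + \<phi> (history_discr R q aS k n w) (w n) v
       - \<phi> (history_discr R q aS k n w) (w n) (w n)
       + clarke_deriv j (\<gamma> (w n)) (\<gamma> v - \<gamma> (w n))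
       \<ge> f (real n * k) (v - w n)"
    have k: "k > 0" and Nk: "real N * k = T" using N T by (auto simp: k_def)
    have grid: "real n * k \<in> {0..T}" if "n \<le> N" for n
      using that k mult_right_mono[of "real n" "real N" k] by (simp flip: Nk)
    define E where "E = (\<lambda>n. norm (u (real n * k) - w n))"
    define dist_to where "dist_to = (\<lambda>n v. norm (u (real n * k) - v) + sqrt (norm (\<gamma> (u (real n * k)) - \<gamma> v)))"
    define \<delta> where "\<delta> = (MAX n\<in>{0..N}. INF v\<in>Xh h. dist_to n v)"
    define X where "X = D * (\<delta> + k\<^sup>2)"
    have XhN: "Xh h \<noteq> {}" using wX by auto
    have INF0: "0 \<le> (INF v\<in>Xh h. dist_to n v)" for n
      by (rule cINF_greatest[OF XhN]) (simp add: dist_to_def)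
    have INF\<delta>: "(INF v\<in>Xh h. dist_to n v) \<le> \<delta>" if "n \<le> N" for n
      unfolding \<delta>_def by (rule Max_ge) (use that in auto)
    have \<delta>0: "\<delta> \<ge> 0" using INF0[of 0] INF\<delta>[of 0] by linarith
    have X0: "X \<ge> 0" using D \<delta>0 by (simp add: X_def)
    define S where "S = (\<lambda>n. k * (\<Sum>i<n. E i))"
    have history: "norm (history_op R q aS u (real n * k) - history_discr R q aS k n w)
        \<le> Ch * k\<^sup>2 + 2 * norm R * Q * S n" if n: "n \<le> N" for n
    proof -
      have 1: "norm (history_op R q aS u (real n * k) - history_discr R q aS k n (\<lambda>i. u (real i * k))) \<le> Ch * k\<^sup>2"
        using Ch(2)[OF k] grid[OF n] by simp
      have 2: "norm (history_discr R q aS k n (\<lambda>i. u (real i * k)) - history_discr R q aS k n w)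
          \<le> 2 * norm R * Q * (k * (\<Sum>i<n. norm (u (real i * k) - w i)))"
        using k n by (intro history_discr_stable Q(2) grid) auto
      then show ?thesis using norm_triangle_mono[OF 1 2] by (simp add: S_def E_def)
    qed
    have step: "E n \<le> (if 2 \<le> n then \<theta> / 3 * (2 * E (n - 1) + E (n - 2)) else 0) + K * (k * (\<Sum>i<n. E i)) + X"
      if n: "n \<le> N" for n
    proof -
      define a' where "a' = u (real n * k)"
      define y where "y = history_op R q aS u (real n * k)"
      define y' where "y' = history_discr R q aS k n w"
      define Z where "Z = (if 2 \<le> n then \<theta> / 3 * (2 * E (n - 1) + E (n - 2)) else 0)"
      have tn: "real n * k \<ge> 0" using grid[OF n] by simp
      note exact = u_solution[OF tn, folded a'_def y_def]
      have \<gamma>a: "norm (\<gamma> a') \<le> U" unfolding a'_def by (rule U[OF grid[OF n]])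
      have \<sigma>: "norm (y - y') \<le> Ch * k\<^sup>2 + 2 * norm R * Q * S n"
        unfolding y_def y'_def by (rule history[OF n])
      have En: "E n = norm (a' - w n)" by (simp add: E_def a'_def)
      have gd: "dist_to n v = norm (a' - v) + sqrt (norm (\<gamma> a' - \<gamma> v))" for v
        by (simp add: dist_to_def a'_def)
      have local: "E n \<le> Z + \<theta> / 3 * M * k\<^sup>2 + Cm * (norm (y - y') + dist_to n v)" if v: "v \<in> Xh h" for v
      proof (cases "2 \<le> n")
        case True
        define b where "b = 2 *\<^sub>R w (n - 1) - w (n - 2)"
        have disc: "A (w n) (v - w n) + \<phi> y' b v - \<phi> y' b (w n) + clarke_deriv j (\<gamma> (w n)) (\<gamma> v - \<gamma> (w n))
          + jc (\<gamma> (w n)) (\<gamma> v - \<gamma> (w n)) \<ge> f (real n * k) (v - w n) + jc (\<gamma> b) (\<gamma> v - \<gamma> (w n))"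
          using scheme True n v by (simp add: y'_def b_def blinfun.diff_right blinfun.scaleR_right)
        have "mA * (E n)\<^sup>2 \<le> (\<alpha>\<phi> * norm (a' - b) + \<beta>\<phi> * norm (y - y')) * (E n + norm (a' - v))
          + LA * E n * norm (a' - v) + 4 * c\<phi> * (norm (a' - v))\<^sup>2 + 2 * (G * norm (\<gamma> a' - \<gamma> v))
          + c1 * cj\<^sup>2 * E n * norm (a' - v) + (\<alpha>j - \<alpha>j) * cj\<^sup>2 * (E n)\<^sup>2
          + \<alpha>c * cj\<^sup>2 * (norm (a' - b) * E n + (E n + norm (a' - b)) * norm (a' - v))"
          unfolding En G_def
          by (rule step_inequality[where A=A and \<phi>=\<phi> and jc=jc and j=j and \<gamma>=\<gamma> and F="f (real n * k)",
                OF cj A_lipschitz(2) A_monotone(2) less_imp_le[OF \<phi>_bound(1)] less_imp_le[OF \<phi>_bound(2)]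
                \<phi>_bound(3) j_lipschitz j_growth(2,3) j_relaxed(2) jc_linear jc_bound jc_coercive order_refl
                \<phi>_midpoint(2) exact disc \<gamma>a])
        then have "mA * (E n)\<^sup>2 \<le> (a * norm (a' - b) + \<beta>\<phi> * norm (y - y')
              + (LA + c1 * cj\<^sup>2 + \<alpha>c * cj\<^sup>2) * norm (a' - v)) * E n
            + (a * norm (a' - b) * norm (a' - v) + \<beta>\<phi> * norm (y - y') * norm (a' - v)
              + (4 * c\<phi>) * (norm (a' - v))\<^sup>2 + (2 * G) * norm (\<gamma> a' - \<gamma> v))"
          by (simp add: a_def algebra_simps)
        then have est: "E n \<le> (a / mA + \<epsilon>) * norm (a' - b) + Ca * (norm (y - y') + dist_to n v)"
          unfolding gd by (intro Ca(2)) (auto simp: E_def)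
        have "norm (a' - b) \<le> M * k\<^sup>2 + (2 * E (n - 1) + E (n - 2))"
        proof -
          \<comment> \<open>The extrapolation error is a second difference of \<open>u\<close> plus the extrapolated earlier errors.\<close>
          have "a' - b = (u (real (n - 1) * k + k) - 2 *\<^sub>R u (real (n - 1) * k) + u (real (n - 1) * k - k))
            + (2 *\<^sub>R (u (real (n - 1) * k) - w (n - 1)) - (u (real (n - 2) * k) - w (n - 2)))"
            using True by (simp add: a'_def b_def of_nat_diff algebra_simps)
          moreover have "norm (u (real (n - 1) * k + k) - 2 *\<^sub>R u (real (n - 1) * k) + u (real (n - 1) * k - k)) \<le> M * k\<^sup>2"
            by (rule M(2)) (use grid[OF n] grid[of "n - 2"] n True k in \<open>auto simp: of_nat_diff algebra_simps\<close>)
          moreover have "norm (2 *\<^sub>R (u (real (n - 1) * k) - w (n - 1)) - (u (real (n - 2) * k) - w (n - 2)))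
            \<le> 2 * E (n - 1) + E (n - 2)"
            using norm_triangle_ineq4[of "2 *\<^sub>R (u (real (n - 1) * k) - w (n - 1))" "u (real (n - 2) * k) - w (n - 2)"]
            by (simp add: E_def)
          ultimately show ?thesis by (metis norm_triangle_mono)
        qed
        then have "(a / mA + \<epsilon>) * norm (a' - b) \<le> (\<theta> / 3) * (M * k\<^sup>2 + (2 * E (n - 1) + E (n - 2)))"
          using \<theta>(1) unfolding \<theta>3 by (intro mult_left_mono) auto
        also have "\<dots> = \<theta> / 3 * M * k\<^sup>2 + Z" using True by (simp add: Z_def algebra_simps)
        finally have "(a / mA + \<epsilon>) * norm (a' - b) \<le> \<theta> / 3 * M * k\<^sup>2 + Z" .
        moreover have "Ca * (norm (y - y') + dist_to n v) \<le> Cm * (norm (y - y') + dist_to n v)"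
          using Cm by (intro mult_right_mono) (auto simp: dist_to_def)
        ultimately show ?thesis using est by linarith
      next
        case False
        then have n01: "n \<in> {0, 1}" by auto
        have disc: "A (w n) (v - w n) + \<phi> y' (w n) v - \<phi> y' (w n) (w n)
          + clarke_deriv j (\<gamma> (w n)) (\<gamma> v - \<gamma> (w n))
          + blinfun_apply ((\<lambda>z. 0) (\<gamma> (w n))) (\<gamma> v - \<gamma> (w n))
          \<ge> f (real n * k) (v - w n) + blinfun_apply ((\<lambda>z. 0) (\<gamma> (w n))) (\<gamma> v - \<gamma> (w n))"
          using bspec[OF bspec[OF start n01] v] by (simp add: y'_def)
        have "mA * (E n)\<^sup>2 \<le> (\<alpha>\<phi> * E n + \<beta>\<phi> * norm (y - y')) * (E n + norm (a' - v))
          + LA * E n * norm (a' - v) + 4 * c\<phi> * (norm (a' - v))\<^sup>2 + 2 * (G * norm (\<gamma> a' - \<gamma> v))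
          + c1 * cj\<^sup>2 * E n * norm (a' - v) + (\<alpha>j - 0) * cj\<^sup>2 * (E n)\<^sup>2
          + 0 * cj\<^sup>2 * (E n * E n + (E n + E n) * norm (a' - v))"
          unfolding En G_def
          by (rule step_inequality[where A=A and \<phi>=\<phi> and jc="\<lambda>z. 0" and j=j and \<gamma>=\<gamma> and F="f (real n * k)"
                and \<alpha>c=0 and \<mu>=0,
                OF cj A_lipschitz(2) A_monotone(2) less_imp_le[OF \<phi>_bound(1)] less_imp_le[OF \<phi>_bound(2)]
                \<phi>_bound(3) j_lipschitz j_growth(2,3) j_relaxed(2) linear_zero order_refl _ _
                less_imp_le[OF j_relaxed(1)] \<phi>_midpoint(2) exact disc \<gamma>a]) auto
        then have "m0 * (E n)\<^sup>2 \<le> (0 * 0 + \<beta>\<phi> * norm (y - y') + (\<alpha>\<phi> + LA + c1 * cj\<^sup>2) * norm (a' - v)) * E n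
          + (0 * 0 * norm (a' - v) + \<beta>\<phi> * norm (y - y') * norm (a' - v) + (4 * c\<phi>) * (norm (a' - v))\<^sup>2
          + (2 * G) * norm (\<gamma> a' - \<gamma> v))"
          by (simp add: m0_def power2_eq_square algebra_simps)
        then have "E n \<le> (0 / m0 + 1) * 0 + Cb * (norm (y - y') + dist_to n v)"
          unfolding gd by (intro Cb(2)) (auto simp: E_def)
        moreover have "Cb * (norm (y - y') + dist_to n v) \<le> Cm * (norm (y - y') + dist_to n v)"
          using Cm by (intro mult_right_mono) (auto simp: dist_to_def)
        moreover have "0 \<le> \<theta> / 3 * M * k\<^sup>2" using \<theta>(1) M(1) by simp
        ultimately show ?thesis using False by (simp add: Z_def)
      qed
      have "E n \<le> (Z + \<theta> / 3 * M * k\<^sup>2 + Cm * norm (y - y')) + Cm * (INF v\<in>Xh h. dist_to n v)"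
        by (intro le_cINF_affine XhN Cm(1)) (use local in \<open>simp add: distrib_left add.assoc\<close>)
      also have "\<dots> \<le> (Z + \<theta> / 3 * M * k\<^sup>2 + Cm * (Ch * k\<^sup>2 + 2 * norm R * Q * S n)) + Cm * \<delta>"
        by (intro add_mono order_refl mult_left_mono[OF \<sigma>] mult_left_mono[OF INF\<delta>[OF n]] less_imp_le[OF Cm(1)])
      also have "\<dots> = Z + Cm * (2 * norm R * Q) * S n + (\<theta> / 3 * M + Cm * Ch) * k\<^sup>2 + Cm * \<delta>"
        by (simp add: algebra_simps)
      also have "\<dots> \<le> Z + K * S n + D * k\<^sup>2 + D * \<delta>"
      proof (intro add_mono mult_right_mono order_refl)
        show "0 \<le> S n" using k by (simp add: S_def E_def sum_nonneg)
      qed (use \<delta>0 D Cm in \<open>auto simp: K_def D_def\<close>)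
      finally show ?thesis by (simp add: Z_def S_def X_def algebra_simps)
    qed
    have "E n \<le> C * (\<delta> + k\<^sup>2)" if "n \<le> N" for n
    proof -
      have "E n \<le> 2 / (1 - \<theta>) * exp (2 * K / (1 - \<theta>) * T) * X"
        by (rule two_step_gronwall[where N=N and k=k, OF _ \<theta> K _ _ X0 step that])
          (use k Nk in \<open>auto simp: E_def\<close>)
      then show ?thesis by (simp add: C_def X_def mult_ac)
    qed
    then show "(MAX n\<in>{0..N}. norm (u (real n * k) - w n))
      \<le> C * ((MAX n\<in>{0..N}. INF v\<in>Xh h.
                 norm (u (real n * k) - v) + sqrt (norm (\<gamma> (u (real n * k)) - \<gamma> v)))
              + k\<^sup>2)"
      unfolding E_def \<delta>_def dist_to_def by (intro Max.boundedI) auto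
  qed
qed

end
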